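(* Let $K\in[0,\mu(\Omega)]$ and let $(\rho^{(k)})_{k\in\mathbb{N}}$ be a sequence with $\rho^{(k)}>0$ and $\lim_{k\to\infty}\rho^{(k)}=\infty$. For every $k\in\mathbb{N}$ let $u^{(k)}$ be a global solution of the penalized problem $$\text{Minimize } f(u)+\rho^{(k)}\,\phi(u)\quad\text{over } u\in U,\qquad \phi(u):=\|W(u)\|_1-|||W(u)|||_K .$$ Then the sequence $(u^{(k)})$ is bounded in $U$, satisfies $\lim_{k\to\infty}\phi(u^{(k)})=0$, and every weak accumulation point $\overline{u}$ of $(u^{(k)})$ is a global solution of the problem $$\text{Minimize } f(u)\quad\text{over } u\in U\quad\text{subject to } \|\nabla u\|_0\le K .$$
   Context: Standing assumptions: $\Omega\subseteq\mathbb{R}^d$ ($d\in\mathbb{N}$) is open and bounded, $\mu$ is the Lebesgue measure. $U$ is a reflexive Banach space that is compactly embedded in $H^1(\Omega)$ and dense in $L^1(\Omega)$. The objective $f\colon U\to\mathbb{R}\cup\{+\infty\}$ is proper, convex, lower semicontinuous, bounded from below and radially unbounded (i.e. $f(u)\to+\infty$ as $\|u\|_U\to\infty$). There exists $u\in U$ with $f(u)<\infty$ and $\|\nabla u\|_0\le K$. Notation: $\nabla u=(\partial u/\partial x_1,\dots,\partial u/\partial x_d)^\top$ is the weak gradient of $u\in U$, and $W(u):=\sum_{i=1}^d(\partial u/\partial x_i)^2\in L^1(\Omega)$. The support of the gradient is $\operatorname{supp}(\nabla u):=\{x\in\Omega: \nabla u(x)\ne 0\}=\operatorname{supp}(W(u))$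 (set-theoretic support, up to null sets), and $\|\nabla u\|_0:=\mu(\operatorname{supp}(\nabla u))$. $\|\cdot\|_1$ is the $L^1(\Omega)$-norm. For $v\in L^1(\Omega)$ the largest-$K$-norm is $|||v|||_K:=\sup\{\int_A|v|\,d\mu : A\subseteq\Omega \text{ measurable},\ \mu(A)\le K\}$. *)

theory Defs
  imports "HOL-Analysis.Analysis"
begin

text \<open>
  Elements of \<open>L\<^sup>p(\<Omega>)\<close> and \<open>H\<^sup>1(\<Omega>)\<close> are represented by functions on the whole space of which only
  the values on \<open>\<Omega>\<close> matter; equality in these spaces is equality almost everywhere
  with respect to \<^term>\<open>lebesgue_on \<Omega>\<close>.
\<close>

primrec C_k :: "nat \<Rightarrow> (real^'n \<Rightarrow> real) \<Rightarrow> bool" where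
  "C_k 0 \<psi> \<longleftrightarrow> continuous_on UNIV \<psi>"
| "C_k (Suc k) \<psi> \<longleftrightarrow> (\<forall>x. \<psi> differentiable at x) \<and>
     (\<forall>i. C_k k (\<lambda>x. frechet_derivative \<psi> (at x) (axis i 1)))"

definition test_function :: "(real^'n) set \<Rightarrow> (real^'n \<Rightarrow> real) \<Rightarrow> bool" where
  "test_function \<Omega> \<psi> \<longleftrightarrow>
     (\<forall>k. C_k k \<psi>) \<and> compact (closure {x. \<psi> x \<noteq> 0}) \<and> closure {x. \<psi> x \<noteq> 0} \<subseteq> \<Omega>"

definition locally_integrable :: "(real^'n) set \<Rightarrow> (real^'n \<Rightarrow> real) \<Rightarrow> bool" where
  "locally_integrable \<Omega> v \<longleftrightarrow> (\<forall>C. compact C \<and> C \<subseteq> \<Omega> \<longrightarrow> integrable (lebesgue_on C) v)"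

definition has_weak_gradient ::
  "(real^'n) set \<Rightarrow> (real^'n \<Rightarrow> real) \<Rightarrow> (real^'n \<Rightarrow> real^'n) \<Rightarrow> bool" where
  "has_weak_gradient \<Omega> v g \<longleftrightarrow>
     locally_integrable \<Omega> v \<and> (\<forall>i. locally_integrable \<Omega> (\<lambda>x. g x $ i)) \<and>
     (\<forall>\<psi> i. test_function \<Omega> \<psi> \<longrightarrow>
        (\<integral>x. v x * frechet_derivative \<psi> (at x) (axis i 1) \<partial>lebesgue_on \<Omega>) =
        - (\<integral>x. g x $ i * \<psi> x \<partial>lebesgue_on \<Omega>))"

text \<open>The weak gradient is unique only up to null sets of \<open>\<Omega>\<close>; this picks a representative.\<close>

definition weak_gradient :: "(real^'n) set \<Rightarrow> (real^'n \<Rightarrow> real) \<Rightarrow> real^'n \<Rightarrow> real^'n" where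
  "weak_gradient \<Omega> v = (SOME g. has_weak_gradient \<Omega> v g)"

definition L2_fun :: "(real^'n) set \<Rightarrow> (real^'n \<Rightarrow> real) \<Rightarrow> bool" where
  "L2_fun \<Omega> v \<longleftrightarrow>
     v \<in> borel_measurable (lebesgue_on \<Omega>) \<and> integrable (lebesgue_on \<Omega>) (\<lambda>x. (v x)\<^sup>2)"

definition H1 :: "(real^'n) set \<Rightarrow> (real^'n \<Rightarrow> real) set" where
  "H1 \<Omega> = {v. L2_fun \<Omega> v \<and>
     (\<exists>g. has_weak_gradient \<Omega> v g \<and> (\<forall>i. L2_fun \<Omega> (\<lambda>x. g x $ i)))}"

definition H1_norm :: "(real^'n) set \<Rightarrow> (real^'n \<Rightarrow> real) \<Rightarrow> real" where
  "H1_norm \<Omega> v = sqrt ((\<integral>x. (v x)\<^sup>2 \<partial>lebesgue_on \<Omega>) +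
     (\<Sum>i\<in>UNIV. \<integral>x. (weak_gradient \<Omega> v x $ i)\<^sup>2 \<partial>lebesgue_on \<Omega>))"

text \<open>
  \<open>U\<close> is an abstract Banach space \<open>'u\<close> together with an embedding \<open>j\<close> choosing for every element
  a representing function. Hence linearity and injectivity of \<open>j\<close> are modulo null sets.
\<close>

definition compactly_embedded_H1 ::
  "(real^'n) set \<Rightarrow> ('u::real_normed_vector \<Rightarrow> real^'n \<Rightarrow> real) \<Rightarrow> bool" where
  "compactly_embedded_H1 \<Omega> j \<longleftrightarrow>
     (\<forall>u. j u \<in> H1 \<Omega>) \<and>
     (\<forall>u v. AE x in lebesgue_on \<Omega>. j (u + v) x = j u x + j v x) \<and>
     (\<forall>c u. AE x in lebesgue_on \<Omega>. j (c *\<^sub>R u) x = c * j u x) \<and>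
     (\<forall>u. (AE x in lebesgue_on \<Omega>. j u x = 0) \<longrightarrow> u = 0) \<and>
     (\<exists>C. \<forall>u. H1_norm \<Omega> (j u) \<le> C * norm u) \<and>
     (\<forall>s::nat \<Rightarrow> 'u. bounded (range s) \<longrightarrow>
        (\<exists>r w. strict_mono r \<and> w \<in> H1 \<Omega> \<and>
           (\<lambda>n. H1_norm \<Omega> (\<lambda>x. j (s (r n)) x - w x)) \<longlonglongrightarrow> 0))"

definition dense_in_L1 :: "(real^'n) set \<Rightarrow> ('u \<Rightarrow> real^'n \<Rightarrow> real) \<Rightarrow> bool" where
  "dense_in_L1 \<Omega> j \<longleftrightarrow>
     (\<forall>u. integrable (lebesgue_on \<Omega>) (j u)) \<and>
     (\<forall>h. integrable (lebesgue_on \<Omega>) h \<longrightarrow>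
        (\<forall>\<epsilon>>0. \<exists>u. (\<integral>x. \<bar>h x - j u x\<bar> \<partial>lebesgue_on \<Omega>) < \<epsilon>))"

text \<open>Surjectivity of the canonical map into the bidual.\<close>

definition reflexive_space :: "'u::real_normed_vector itself \<Rightarrow> bool" where
  "reflexive_space _ \<longleftrightarrow>
     (\<forall>F :: ('u \<Rightarrow>\<^sub>L real) \<Rightarrow>\<^sub>L real. \<exists>x::'u. \<forall>g. blinfun_apply F g = blinfun_apply g x)"

definition weak_topology :: "'u::real_normed_vector topology" where
  "weak_topology =
     topology_generated_by {blinfun_apply g -` V | (g :: 'u \<Rightarrow>\<^sub>L real) V. open V}"

definition weak_accumulation_point :: "'u::real_normed_vector \<Rightarrow> (nat \<Rightarrow> 'u) \<Rightarrow> bool" where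
  "weak_accumulation_point x s \<longleftrightarrow>
     (\<forall>V. openin weak_topology V \<and> x \<in> V \<longrightarrow> (\<exists>\<^sub>F n in sequentially. s n \<in> V))"

text \<open>In particular, weak limits of subsequences are weak accumulation points.\<close>

lemma weak_accumulation_point_subsequence:
  fixes s :: "nat \<Rightarrow> 'u::real_normed_vector"
  assumes r: "strict_mono r"
    and lim: "\<And>g :: 'u \<Rightarrow>\<^sub>L real. (\<lambda>n. blinfun_apply g (s (r n))) \<longlonglongrightarrow> blinfun_apply g x"
  shows "weak_accumulation_point x s"
  unfolding weak_accumulation_point_def
proof (intro allI impI, elim conjE)
  fix V assume V: "openin weak_topology V" and x: "x \<in> V"
  let ?S = "{blinfun_apply g -` V | (g :: 'u \<Rightarrow>\<^sub>L real) V. open V}"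
  have "generate_topology_on ?S V"
    using V unfolding weak_topology_def openin_topology_generated_by_iff .
  then have "x \<in> V \<longrightarrow> (\<forall>\<^sub>F n in sequentially. s (r n) \<in> V)"
  proof (induction rule: generate_topology_on.induct)
    case (Int a b)
    then show ?case by (auto intro: eventually_conj)
  next
    case (UN K)
    show ?case
    proof
      assume "x \<in> \<Union> K"
      then obtain X where X: "X \<in> K" "x \<in> X" by blast
      with UN have "\<forall>\<^sub>F n in sequentially. s (r n) \<in> X" by blast
      then show "\<forall>\<^sub>F n in sequentially. s (r n) \<in> \<Union> K"
        by (rule eventually_mono) (use X in blast)
    qed
  next
    case (Basis a)
    then obtain g :: "'u \<Rightarrow>\<^sub>L real" and W where "a = blinfun_apply g -` W" "open W" by blast
    then show ?case using topological_tendstoD[OF lim] by auto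
  qed auto
  with x have "\<exists>\<^sub>F n in sequentially. s (r n) \<in> V"
    by (simp add: eventually_frequently)
  then show "\<exists>\<^sub>F n in sequentially. s n \<in> V"
    unfolding frequently_sequentially by (meson r seq_suble order_trans)
qed

definition ereal_convex :: "('u::real_vector \<Rightarrow> ereal) \<Rightarrow> bool" where
  "ereal_convex f \<longleftrightarrow> (\<forall>x y t. 0 \<le> t \<and> t \<le> 1 \<longrightarrow>
     f ((1 - t) *\<^sub>R x + t *\<^sub>R y) \<le> ereal (1 - t) * f x + ereal t * f y)"

definition lower_semicontinuous :: "('u::topological_space \<Rightarrow> ereal) \<Rightarrow> bool" where
  "lower_semicontinuous f \<longleftrightarrow> (\<forall>x. f x \<le> Liminf (at x) f)"

definition grad_sq :: "(real^'n) set \<Rightarrow> (real^'n \<Rightarrow> real) \<Rightarrow> real^'n \<Rightarrow> real" where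
  "grad_sq \<Omega> v x = (\<Sum>i\<in>UNIV. (weak_gradient \<Omega> v x $ i)\<^sup>2)"

definition grad_L0 :: "(real^'n) set \<Rightarrow> (real^'n \<Rightarrow> real) \<Rightarrow> real" where
  "grad_L0 \<Omega> v = measure lebesgue {x \<in> \<Omega>. weak_gradient \<Omega> v x \<noteq> 0}"

definition L1_norm :: "(real^'n) set \<Rightarrow> (real^'n \<Rightarrow> real) \<Rightarrow> real" where
  "L1_norm \<Omega> w = (\<integral>x. \<bar>w x\<bar> \<partial>lebesgue_on \<Omega>)"

definition largest_K_norm :: "(real^'n) set \<Rightarrow> real \<Rightarrow> (real^'n \<Rightarrow> real) \<Rightarrow> real" where
  "largest_K_norm \<Omega> K w =
     (SUP A\<in>{A \<in> sets lebesgue. A \<subseteq> \<Omega> \<and> emeasure lebesgue A \<le> ennreal K}.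
        \<integral>x. \<bar>w x\<bar> \<partial>lebesgue_on A)"

definition penalty :: "(real^'n) set \<Rightarrow> real \<Rightarrow> (real^'n \<Rightarrow> real) \<Rightarrow> real" where
  "penalty \<Omega> K v = L1_norm \<Omega> (grad_sq \<Omega> v) - largest_K_norm \<Omega> K (grad_sq \<Omega> v)"

end

theory Submission
  imports Defs
begin

text \<open>
  Comparing the penalized minimizers with feasible points, whose penalty vanishes, gives
  \<open>f u\<^sub>k + \<rho>\<^sub>k \<phi> u\<^sub>k \<le> f v\<close> for all feasible \<open>v\<close>. As \<open>f\<close> is radially unbounded and bounded below,
  the iterates are bounded and \<open>\<phi> u\<^sub>k \<rightarrow> 0\<close>. A weak accumulation point lies in every closed convex
  set \<open>{f \<le> f v}\<close>, since such sets are weakly closed by Hahn-Banach. It is feasible: by compactness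
  of the embedding the iterates come arbitrarily close to it in \<open>H\<^sup>1\<close>, the penalty is continuous
  there, and a vanishing penalty forces the gradient support to have measure at most \<open>K\<close>.
  That weak gradients depend linearly on the function, although \<open>weak_gradient\<close> is an
  arbitrary choice, rests on the fundamental lemma of the calculus of variations.
\<close>

section \<open>Smooth bumps and the fundamental lemma of the calculus of variations\<close>

text \<open>The obstacle is that a weak accumulation point is a cluster point of the weak topology
  and comes with no weakly convergent subsequence, so the usual argument that compact maps turn weak
  into strong convergence has nothing to act on. Moreover, the limits supplied by the compact
  embedding are elements of \<open>H1 \<Omega>\<close> that are not tied to the accumulation point.
  Convex separation bridges the gap, and it is therefore used twice: for the sublevel sets of
  \<open>f\<close>, and for balls of the H1 distance, which are convex subsets of U at positive norm
  distance from the accumulation point. The result is closeness for frequently many iterates rather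
  than a limit; this suffices because the penalty is eventually small, so one iterate has both
  properties. For the fundamental lemma, indicators of boxes are approximated by powers built from
  one explicit bump; no mollification is involved.\<close>

lemma C_k_SucD:
  fixes \<psi> :: "real^'n \<Rightarrow> real"
  shows "C_k (Suc k) \<psi> \<Longrightarrow> C_k k \<psi>"
proof (induction k arbitrary: \<psi>)
  case 0
  then show ?case
    by (auto intro!: continuous_at_imp_continuous_on differentiable_imp_continuous_within)
next
  case (Suc k)
  then show ?case
    by (metis C_k.simps(2))
qed

text \<open>Derivatives are unique, so any explicit family \<open>D\<close> can stand in for
  \<open>frechet_derivative\<close> in the recursion.\<close>

lemma C_k_SucI:
  fixes \<psi> :: "real^'n \<Rightarrow> real"
  assumes "\<And>x. (\<psi> has_derivative D x) (at x)" and "\<And>i. C_k k (\<lambda>x. D x (axis i 1))"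
  shows "C_k (Suc k) \<psi>"
proof -
  have "frechet_derivative \<psi> (at x) = D x" for x
    using frechet_derivative_at[OF assms(1)] by simp
  then show ?thesis
    using assms by (auto intro: differentiableI)
qed

lemma C_k_has_derivative:
  "C_k (Suc k) \<psi> \<Longrightarrow> (\<psi> has_derivative frechet_derivative \<psi> (at x)) (at x)"
  using frechet_derivative_works by auto

lemma C_k_const: "C_k k (\<lambda>x::real^'n. c)"
proof (induction k arbitrary: c)
  case (Suc k)
  then show ?case
    by (intro C_k_SucI[where D = "\<lambda>_ _. 0"]) auto
qed simp

lemma C_k_add:
  fixes \<phi> \<psi> :: "real^'n \<Rightarrow> real"
  shows "C_k k \<phi> \<Longrightarrow> C_k k \<psi> \<Longrightarrow> C_k k (\<lambda>x. \<phi> x + \<psi> x)"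
proof (induction k arbitrary: \<phi> \<psi>)
  case 0
  then show ?case by (auto intro: continuous_intros)
next
  case (Suc k)
  show ?case
  proof (rule C_k_SucI)
    show "((\<lambda>x. \<phi> x + \<psi> x) has_derivative
        (\<lambda>h. frechet_derivative \<phi> (at x) h + frechet_derivative \<psi> (at x) h)) (at x)" for x
      by (intro has_derivative_add C_k_has_derivative[OF Suc.prems(1)]
          C_k_has_derivative[OF Suc.prems(2)])
    show "C_k k (\<lambda>x. frechet_derivative \<phi> (at x) (axis i 1) + frechet_derivative \<psi> (at x) (axis i 1))"
      for i
      using Suc by simp
  qed
qed

lemma C_k_mult:
  fixes \<phi> \<psi> :: "real^'n \<Rightarrow> real"
  shows "C_k k \<phi> \<Longrightarrow> C_k k \<psi> \<Longrightarrow> C_k k (\<lambda>x. \<phi> x * \<psi> x)"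
proof (induction k arbitrary: \<phi> \<psi>)
  case 0
  then show ?case by (auto intro: continuous_intros)
next
  case (Suc k)
  show ?case
  proof (rule C_k_SucI)
    show "((\<lambda>x. \<phi> x * \<psi> x) has_derivative
        (\<lambda>h. \<phi> x * frechet_derivative \<psi> (at x) h + frechet_derivative \<phi> (at x) h * \<psi> x)) (at x)" for x
      by (intro has_derivative_mult C_k_has_derivative[OF Suc.prems(1)]
          C_k_has_derivative[OF Suc.prems(2)])
    show "C_k k (\<lambda>x. \<phi> x * frechet_derivative \<psi> (at x) (axis i 1)
        + frechet_derivative \<phi> (at x) (axis i 1) * \<psi> x)" for i
      using Suc.prems C_k_SucD[OF Suc.prems(1)] C_k_SucD[OF Suc.prems(2)]
      by (intro C_k_add Suc.IH) auto
  qed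
qed

lemma C_k_power: "C_k k \<psi> \<Longrightarrow> C_k k (\<lambda>x. \<psi> x ^ m)"
  by (induction m) (auto simp del: C_k.simps intro: C_k_const C_k_mult)

lemma C_k_prod:
  "(\<And>i. i \<in> I \<Longrightarrow> C_k k (\<psi> i)) \<Longrightarrow> C_k k (\<lambda>x. \<Prod>i\<in>I. \<psi> i x)"
  by (induction I rule: infinite_finite_induct) (auto simp del: C_k.simps intro: C_k_const C_k_mult)

text \<open>Smoothness of a one-variable function is given as a ladder \<open>h 0, h 1, ...\<close>
  of successive derivatives. The induction keeps \<open>n\<close> arbitrary because each partial
  derivative climbs one rung and picks up only a constant factor.\<close>

lemma C_k_coordinate:
  fixes h :: "nat \<Rightarrow> real \<Rightarrow> real" and i :: "'n::finite"
  assumes h: "\<And>n t. (h n has_real_derivative h (Suc n) t) (at t)"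
  shows "C_k k (\<lambda>x::real^'n. h n (c + s * x $ i))"
proof (induction k arbitrary: n)
  case 0
  have "continuous_on UNIV (h n)"
    using h by (meson DERIV_isCont continuous_at_imp_continuous_on)
  moreover have "continuous_on UNIV (\<lambda>x::real^'n. c + s * x $ i)"
    by (intro continuous_intros)
  ultimately show ?case
    using continuous_on_compose2[of UNIV "h n"] by simp
next
  case (Suc k)
  show ?case
  proof (rule C_k_SucI)
    show "((\<lambda>x. h n (c + s * x $ i)) has_derivative
        (\<lambda>y. h (Suc n) (c + s * x $ i) * (s * y $ i))) (at x)" for x
    proof -
      have "((\<lambda>x. c + s * x $ i) has_derivative (\<lambda>y. 0 + s * y $ i)) (at x)"
        by (intro has_derivative_add has_derivative_const has_derivative_mult_right
            bounded_linear_imp_has_derivative bounded_linear_vec_nth)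
      from has_derivative_compose[OF this h[unfolded has_field_derivative_def]]
      show ?thesis by simp
    qed
    show "C_k k (\<lambda>x. h (Suc n) (c + s * x $ i) * (s * axis l 1 $ i))" for l
      using Suc by (intro C_k_mult C_k_const)
  qed
qed

text \<open>The functions \<open>P(1/t) e\<^sup>-\<^sup>1\<^sup>/\<^sup>t\<close>, continued by zero to \<open>t \<le> 0\<close>, are closed under differentiation.\<close>

definition flat :: "real poly \<Rightarrow> real \<Rightarrow> real" where
  "flat p t = (if t \<le> 0 then 0 else poly p (1 / t) * exp (- (1 / t)))"

lemma poly_exp_tendsto_0: "((\<lambda>x. poly p x * exp (- x)) \<longlongrightarrow> (0::real)) at_top"
proof -
  have "((\<lambda>x. \<Sum>i\<le>degree p. coeff p i * (x ^ i / exp x)) \<longlongrightarrow> (\<Sum>i\<le>degree p. coeff p i * 0)) at_top"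
    by (intro tendsto_sum tendsto_mult tendsto_const tendsto_power_div_exp_0)
  moreover have "(\<Sum>i\<le>degree p. coeff p i * (x ^ i / exp x)) = poly p x * exp (- x)" for x
    by (simp add: poly_altdef exp_minus field_simps sum_divide_distrib)
  ultimately show ?thesis by simp
qed

text \<open>With y = 1/t and y' = -y^2, the derivative of p(y) exp(-y) is y^2 (p(y) - p'(y))
  exp(-y); this is the polynomial in the statement. Only t = 0 needs a limit.\<close>

lemma flat_has_derivative:
  "(flat p has_real_derivative flat ([:0, 0, 1:] * (p - pderiv p)) t) (at t)"
proof -
  consider "t < 0" | "t = 0" | "t > 0" by linarith
  then show ?thesis
  proof cases
    case 1
    have "((\<lambda>_. 0) has_real_derivative 0) (at t)" by simp
    then show ?thesis
      using 1 has_field_derivative_transform_within_open[where S = "{..<0}" and g = "flat p"]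
      by (force simp: flat_def)
  next
    case 3
    have "((\<lambda>t. poly p (1 / t) * exp (- (1 / t))) has_real_derivative
        flat ([:0, 0, 1:] * (p - pderiv p)) t) (at t)"
      using 3 by (auto intro!: derivative_eq_intros DERIV_chain2[OF poly_DERIV]
          simp: flat_def field_simps power2_eq_square)
    then show ?thesis
      by (rule has_field_derivative_transform_within_open[where S = "{0<..}"])
        (use 3 in \<open>auto simp: flat_def\<close>)
  next
    case 2
    \<comment> \<open>For h > 0 the difference quotient at 0 is again of the same type: dividing by
      h multiplies \<open>p\<close> by the variable 1/h.\<close>
    have "((\<lambda>h. poly ([:0, 1:] * p) (inverse h) * exp (- inverse h)) \<longlongrightarrow> 0) (at_right (0::real))"
      by (rule filterlim_compose[OF poly_exp_tendsto_0 filterlim_inverse_at_top_right])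
    then have "((\<lambda>h. flat p h / h) \<longlongrightarrow> 0) (at_right 0)"
      by (rule Lim_transform_eventually)
         (auto simp: flat_def eventually_at_filter field_simps)
    moreover have "((\<lambda>h. flat p h / h) \<longlongrightarrow> 0) (at_left 0)"
      by (rule Lim_transform_eventually[OF tendsto_const])
         (auto simp: flat_def eventually_at_filter)
    ultimately have "((\<lambda>h. flat p h / h) \<longlongrightarrow> 0) (at 0)"
      using filterlim_split_at by blast
    then show ?thesis
      using 2 by (simp add: DERIV_def flat_def)
  qed
qed

lemma C_k_flat_coordinate: "C_k k (\<lambda>x::real^'n. flat p (c + s * x $ i))"
proof -
  define h where "h n = flat (((\<lambda>p. [:0, 0, 1:] * (p - pderiv p)) ^^ n) p)" for n
  have "(h n has_real_derivative h (Suc n) t) (at t)" for n t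
    unfolding h_def using flat_has_derivative by simp
  then show ?thesis
    using C_k_coordinate[of h k 0 c s i] by (simp add: h_def)
qed

lemma flat_1_nonneg: "0 \<le> flat 1 t"
  and flat_1_le: "flat 1 t \<le> 1"
  and flat_1_eq_0_iff: "flat 1 t = 0 \<longleftrightarrow> t \<le> 0"
  by (auto simp: flat_def)

text \<open>The arguments of \<open>flat 1\<close> are the signed distances to the two faces in each
  coordinate, so the product is positive exactly on the open box. The factors 1 and -1 are kept
  explicit to match the affine form \<open>c + s * x $ i\<close>.\<close>

definition box_bump :: "real^'n \<Rightarrow> real^'n \<Rightarrow> real^'n \<Rightarrow> real" where
  "box_bump a b x = (\<Prod>i\<in>UNIV. flat 1 (- a $ i + 1 * x $ i) * flat 1 (b $ i + (- 1) * x $ i))"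

lemma C_k_box_bump: "C_k k (box_bump a b)"
  unfolding box_bump_def by (intro C_k_prod C_k_mult C_k_flat_coordinate)

lemma box_bump_nonneg: "0 \<le> box_bump a b x"
  unfolding box_bump_def by (intro prod_nonneg) (simp add: flat_1_nonneg)

lemma box_bump_le_1: "box_bump a b x \<le> 1"
  unfolding box_bump_def by (intro prod_le_1) (simp add: flat_1_nonneg flat_1_le mult_le_one)

lemma box_bump_eq_0_iff: "box_bump a b x = 0 \<longleftrightarrow> x \<notin> box a b"
  by (auto simp: box_bump_def flat_1_eq_0_iff mem_box_cart not_less)

text \<open>The function vanishes wherever the bump does, but its support is a closure; this is why
  the closed box has to lie in \<open>\<Omega>\<close>.\<close>

lemma test_function_box_bump:
  assumes "cbox a b \<subseteq> \<Omega>"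
  shows "test_function \<Omega> (\<lambda>x. 1 - (1 - box_bump a b x) ^ m)"
proof -
  have "{x. 1 - (1 - box_bump a b x) ^ m \<noteq> 0} \<subseteq> cbox a b"
  proof
    fix x assume "x \<in> {x. 1 - (1 - box_bump a b x) ^ m \<noteq> 0}"
    then have "box_bump a b x \<noteq> 0" by auto
    then show "x \<in> cbox a b"
      using box_bump_eq_0_iff[of a b x] box_subset_cbox[of a b] by auto
  qed
  then have *: "closure {x. 1 - (1 - box_bump a b x) ^ m \<noteq> 0} \<subseteq> cbox a b"
    by (simp add: closure_minimal closed_cbox)
  have "C_k k (\<lambda>x. 1 + (-1) * (1 + (-1) * box_bump a b x) ^ m)" for k
    by (intro C_k_add C_k_mult C_k_power C_k_const C_k_box_bump)
  then show ?thesis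
    using * assms unfolding test_function_def
    by (simp add: compact_eq_bounded_closed) (meson bounded_cbox bounded_subset order_trans)
qed

section \<open>Functions determined by their integrals over boxes\<close>

lemma integrable_lebesgue_on_iff:
  fixes f :: "'a::euclidean_space \<Rightarrow> real"
  assumes "S \<in> sets lebesgue"
  shows "integrable (lebesgue_on S) f \<longleftrightarrow> integrable lebesgue (\<lambda>x. indicator S x * f x)"
  using assms by (simp add: integrable_restrict_space)

lemma integral_lebesgue_on_eq:
  fixes f :: "'a::euclidean_space \<Rightarrow> real"
  assumes "S \<in> sets lebesgue"
  shows "integral\<^sup>L (lebesgue_on S) f = (\<integral>x. indicator S x * f x \<partial>lebesgue)"
  using assms by (simp add: integral_restrict_space)

text \<open>Open boxes are an intersection-stable generator of the Borel sets, so vanishing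
  integrals spread to all Borel sets by Dynkin induction, with \<open>total\<close> feeding the
  complement step. Lebesgue sets differ from Borel sets by null sets, and a density whose integral
  over every measurable set is 0 vanishes almost everywhere.\<close>

lemma AE_eq_0_if_box_integrals_0:
  fixes G :: "'a::euclidean_space \<Rightarrow> real"
  assumes G: "integrable lebesgue G"
    and box: "\<And>a b. (\<integral>x. indicator (box a b) x * G x \<partial>lebesgue) = 0"
    and total: "(\<integral>x. G x \<partial>lebesgue) = 0"
  shows "AE x in lebesgue. G x = 0"
proof -
  have int: "integrable lebesgue (\<lambda>x. indicator A x * G x)" if "A \<in> sets lebesgue" for A
    using G that integrable_mult_indicator[of A lebesgue G] by simp
  have borel: "(\<integral>x. indicator A x * G x \<partial>lebesgue) = 0" if "A \<in> sets borel" for A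
  proof -
    have "Int_stable (range (\<lambda>(a::'a, b). box a b))"
      by (auto simp: Int_stable_def box_Int_box)
    moreover have "range (\<lambda>(a::'a, b). box a b) \<subseteq> Pow UNIV" by auto
    moreover have "A \<in> sigma_sets UNIV (range (\<lambda>(a, b). box a b))"
      using that unfolding borel_eq_box by simp
    ultimately show ?thesis
    proof (induction rule: sigma_sets_induct_disjoint)
      case (basic A)
      then show ?case using box by auto
    next
      case (compl A)
      then have A: "A \<in> sets lebesgue"
        by (simp add: borel_eq_box sets_completionI_sets)
      have "(\<integral>x. indicator (UNIV - A) x * G x \<partial>lebesgue)
          = (\<integral>x. G x - indicator A x * G x \<partial>lebesgue)"
        by (rule Bochner_Integration.integral_cong) (auto simp: indicator_def)
      also have "\<dots> = 0"
        using G int[OF A] compl total by simp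
      finally show ?case .
    next
      case (union F)
      have F: "F i \<in> sets lebesgue" for i
        using range_subsetD[OF union.hyps(2), of i] by (simp add: borel_eq_box sets_completionI_sets)
      have "(LINT x:(\<Union>i. F i)|lebesgue. G x) = (\<Sum>i. (LINT x:(F i)|lebesgue. G x))"
      proof (rule lebesgue_integral_countable_add)
        show "set_integrable lebesgue (\<Union>i. F i) G"
          using int[of "\<Union>i. F i"] F by (auto simp: set_integrable_def)
      qed (use F union.hyps(1) in \<open>auto simp: disjoint_family_on_def\<close>)
      then show ?case
        using union.IH by (simp add: set_lebesgue_integral_def)
    qed simp
  qed
  have "(LINT x:A|lebesgue. G x) = (LINT x:A|lebesgue. 0)" if A: "A \<in> sets lebesgue" for A
  proof -
    obtain S N N' where S: "A = S \<union> N" "N \<subseteq> N'" "N' \<in> null_sets lborel" "S \<in> sets lborel"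
      using sets_completionE[OF A] by metis
    then have "N' \<in> null_sets lebesgue" by (simp add: null_sets_completionI)
    then have "AE x in lebesgue. x \<notin> N'" by (rule AE_not_in)
    then have *: "AE x in lebesgue. indicator A x * G x = indicator S x * G x"
      by (rule AE_mp) (use S in \<open>auto simp: indicator_def\<close>)
    have "(\<integral>x. indicator A x * G x \<partial>lebesgue) = (\<integral>x. indicator S x * G x \<partial>lebesgue)"
      using A S by (intro integral_cong_AE * borel_measurable_integrable int) auto
    then show ?thesis
      using borel S by (simp add: set_lebesgue_integral_def)
  qed
  then show ?thesis
    using density_unique_real[OF G, of "\<lambda>_. 0"] by simp
qed

text \<open>As \<open>m \<rightarrow> \<infinity>\<close>, the test functions \<open>1 - (1 - bump)\<^sup>m\<close> converge boundedly to the indicator of the box.\<close>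

lemma box_integral_eq_0_if_test_integrals_0:
  fixes g :: "real^'n \<Rightarrow> real"
  assumes \<Omega>: "\<Omega> \<in> sets lebesgue" and g: "locally_integrable \<Omega> g"
    and test: "\<And>\<psi>. test_function \<Omega> \<psi> \<Longrightarrow> (\<integral>x. g x * \<psi> x \<partial>lebesgue_on \<Omega>) = 0"
    and ab: "cbox a b \<subseteq> \<Omega>"
  shows "(\<integral>x. indicator (box a b) x * g x \<partial>lebesgue) = 0"
proof -
  let ?\<psi> = "\<lambda>m x. 1 - (1 - box_bump a b x) ^ m"
  \<comment> \<open>\<open>g\<close> need not be integrable on \<open>\<Omega>\<close>, but it is on
    the compact box; this restriction also provides the dominating function.\<close>
  let ?h = "\<lambda>x. indicator (cbox a b) x * g x"
  have h: "integrable lebesgue ?h"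
    using g ab by (auto simp: locally_integrable_def simp flip: integrable_lebesgue_on_iff)
  have h_meas [measurable]: "?h \<in> borel_measurable lebesgue"
    using h by (rule borel_measurable_integrable)
  have \<psi>_meas: "?\<psi> m \<in> borel_measurable lebesgue" for m
    using C_k_box_bump[of 0 a b]
    by (intro borel_measurable_diff borel_measurable_power measurable_completion)
      (auto intro: borel_measurable_continuous_onI)
  have outside: "?\<psi> m x = 0" if "x \<notin> box a b" for m x
    using that box_bump_eq_0_iff[of a b x] by simp
  have "(\<lambda>m. \<integral>x. ?h x * ?\<psi> m x \<partial>lebesgue) \<longlonglongrightarrow> (\<integral>x. indicator (box a b) x * g x \<partial>lebesgue)"
  proof (rule integral_dominated_convergence[where w = "\<lambda>x. \<bar>?h x\<bar>"])
    have "(\<lambda>x. indicator (box a b) x * ?h x) \<in> borel_measurable lebesgue"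
      by (intro borel_measurable_times borel_measurable_indicator h_meas) auto
    then show "(\<lambda>x. indicator (box a b) x * g x) \<in> borel_measurable lebesgue"
      by (rule measurable_cong[THEN iffD1, rotated])
        (use box_subset_cbox[of a b] in \<open>auto simp: indicator_def\<close>)
    show "integrable lebesgue (\<lambda>x. \<bar>?h x\<bar>)" using h by simp
    show "AE x in lebesgue. (\<lambda>m. ?h x * ?\<psi> m x) \<longlonglongrightarrow> indicator (box a b) x * g x"
    proof (rule AE_I2)
      fix x
      show "(\<lambda>m. ?h x * ?\<psi> m x) \<longlonglongrightarrow> indicator (box a b) x * g x"
      proof (cases "x \<in> box a b")
        case True
        then have "x \<in> cbox a b" using box_subset_cbox[of a b] by auto
        have "0 < box_bump a b x"
          using True box_bump_eq_0_iff[of a b x] box_bump_nonneg[of a b x] by linarith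
        then have "norm (1 - box_bump a b x) < 1"
          using box_bump_le_1[of a b x] by simp
        then have "(\<lambda>m. (1 - box_bump a b x) ^ m) \<longlonglongrightarrow> 0"
          by (rule LIMSEQ_power_zero)
        then have "(\<lambda>m. ?h x * ?\<psi> m x) \<longlonglongrightarrow> ?h x * (1 - 0)"
          by (intro tendsto_mult tendsto_diff tendsto_const)
        then show ?thesis using True \<open>x \<in> cbox a b\<close> by simp
      next
        case False
        then show ?thesis using outside by simp
      qed
    qed
    show "AE x in lebesgue. norm (?h x * ?\<psi> m x) \<le> \<bar>?h x\<bar>" for m
    proof (rule AE_I2)
      fix x
      have "0 \<le> (1 - box_bump a b x) ^ m" "(1 - box_bump a b x) ^ m \<le> 1"
        using box_bump_le_1[of a b x] box_bump_nonneg[of a b x] by (auto intro: power_le_one)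
      then have "\<bar>?\<psi> m x\<bar> \<le> 1" by simp
      then show "norm (?h x * ?\<psi> m x) \<le> \<bar>?h x\<bar>"
        using mult_left_mono[of "\<bar>?\<psi> m x\<bar>" 1 "\<bar>?h x\<bar>"] by (simp add: abs_mult)
    qed
    show "(\<lambda>x. ?h x * ?\<psi> m x) \<in> borel_measurable lebesgue" for m
      by (intro borel_measurable_times h_meas \<psi>_meas)
  qed
  moreover have "(\<integral>x. ?h x * ?\<psi> m x \<partial>lebesgue) = 0" for m
  proof -
    have "(\<integral>x. ?h x * ?\<psi> m x \<partial>lebesgue) = (\<integral>x. g x * ?\<psi> m x \<partial>lebesgue_on \<Omega>)"
      unfolding integral_lebesgue_on_eq[OF \<Omega>]
    proof (rule Bochner_Integration.integral_cong)
      fix x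
      show "?h x * ?\<psi> m x = indicator \<Omega> x * (g x * ?\<psi> m x)"
        using outside[of x m] ab box_subset_cbox[of a b]
        by (cases "x \<in> box a b") (auto simp: indicator_def)
    qed simp
    then show ?thesis using test[OF test_function_box_bump[OF ab]] by simp
  qed
  ultimately show ?thesis
    by (simp add: LIMSEQ_const_iff)
qed

text \<open>The claim is local: on each box whose closure lies in \<open>\<Omega>\<close> the
  cut-off function is integrable on the whole space and all its box integrals vanish. By the
  Lindelof property countably many such boxes cover \<open>\<Omega>\<close>, so the exceptional null
  sets can be united.\<close>

lemma fundamental_lemma_calculus_of_variations:
  fixes g :: "real^'n \<Rightarrow> real"
  assumes \<Omega>: "open \<Omega>" and g: "locally_integrable \<Omega> g"
    and test: "\<And>\<psi>. test_function \<Omega> \<psi> \<Longrightarrow> (\<integral>x. g x * \<psi> x \<partial>lebesgue_on \<Omega>) = 0"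
  shows "AE x in lebesgue_on \<Omega>. g x = 0"
proof -
  have \<Omega>': "\<Omega> \<in> sets lebesgue" using \<Omega> by auto
  have zero: "(\<integral>x. indicator (box a b) x * g x \<partial>lebesgue) = 0" if "cbox a b \<subseteq> \<Omega>" for a b
    by (rule box_integral_eq_0_if_test_integrals_0[OF \<Omega>' g test that])
  have local: "AE x in lebesgue. x \<in> box c d \<longrightarrow> g x = 0" if cd: "cbox c d \<subseteq> \<Omega>" for c d
  proof -
    have "AE x in lebesgue. indicator (box c d) x * g x = 0"
    proof (rule AE_eq_0_if_box_integrals_0)
      have "integrable lebesgue (\<lambda>x. indicator (cbox c d) x * g x)"
        using g cd by (auto simp: locally_integrable_def simp flip: integrable_lebesgue_on_iff)
      then have "integrable lebesgue (\<lambda>x. indicator (box c d) x * (indicator (cbox c d) x * g x))"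
        using integrable_mult_indicator[of "box c d" lebesgue "\<lambda>x. indicator (cbox c d) x * g x"]
        by (simp add: borel_open sets_completionI_sets)
      also have "(\<lambda>x. indicator (box c d) x * (indicator (cbox c d) x * g x))
          = (\<lambda>x. indicator (box c d) x * g x)"
        using box_subset_cbox[of c d] by (auto simp: indicator_def fun_eq_iff)
      finally show "integrable lebesgue (\<lambda>x. indicator (box c d) x * g x)" .
      show "(\<integral>x. indicator (box c d) x * g x \<partial>lebesgue) = 0" by (rule zero[OF cd])
      show "(\<integral>x. indicator (box a b) x * (indicator (box c d) x * g x) \<partial>lebesgue) = 0" for a b
      proof -
        obtain a' b' where ab': "box a b \<inter> box c d = box a' b'"
          unfolding box_Int_box by blast
        have eq: "(\<lambda>x. indicator (box a b) x * (indicator (box c d) x * g x))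
            = (\<lambda>x. indicator (box a' b') x * g x)"
          unfolding ab'[symmetric] by (auto simp: indicator_def)
        show ?thesis
        \<comment> \<open>A nonempty open box has \<open>cbox a' b'\<close> as its closure, which
          stays in \<open>cbox c d\<close>. For an empty box this identity can fail, but then the
          integrand is zero.\<close>
        proof (cases "box a' b' = {}")
          case False
          then have "cbox a' b' = closure (box a' b')" by simp
          also have "\<dots> \<subseteq> cbox c d"
            unfolding ab'[symmetric] by (rule closure_minimal) (use box_subset_cbox[of c d] in auto)
          finally show ?thesis
            unfolding eq using cd by (intro zero) auto
        qed (simp add: eq)
      qed
    qed
    then show ?thesis by (rule AE_mp) (auto simp: indicator_def)
  qed
  let ?B = "{B. \<exists>c d. B = box c d \<and> cbox c d \<subseteq> \<Omega>}"
  obtain B where B: "B \<subseteq> ?B" "countable B" "\<Union>B = \<Union>?B"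
    using Lindelof[of ?B] by (auto simp: open_box)
  have "AE x in lebesgue. \<forall>S\<in>B. x \<in> S \<longrightarrow> g x = 0"
    using B local by (subst AE_ball_countable) auto
  moreover have "x \<in> \<Union>B" if "x \<in> \<Omega>" for x
  proof -
    obtain c d where "cbox c d \<subseteq> \<Omega>" "x \<in> box c d"
      using open_contains_cbox[OF \<Omega> \<open>x \<in> \<Omega>\<close>] by metis
    then show ?thesis unfolding B(3) by blast
  qed
  ultimately show ?thesis
    using \<Omega>' by (auto simp: AE_restrict_space_iff elim!: AE_mp)
qed

section \<open>Weak gradients\<close>

text \<open>Completeness of Lebesgue measure. Measurability has to be carried along
  almost-everywhere equality because \<open>j\<close> is linear only modulo null sets and
  \<open>weak_gradient\<close> is an arbitrary representative.\<close>

lemma borel_measurable_lebesgue_on_AE: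
  fixes f g :: "'a::euclidean_space \<Rightarrow> real"
  assumes S: "S \<in> sets lebesgue" and f: "f \<in> borel_measurable (lebesgue_on S)"
    and ae: "AE x in lebesgue_on S. f x = g x"
  shows "g \<in> borel_measurable (lebesgue_on S)"
proof -
  have "(\<lambda>x. if x \<in> S then f x else 0) \<in> borel_measurable lebesgue"
    using f S by (simp add: borel_measurable_if)
  moreover have "AE x in lebesgue. (if x \<in> S then f x else 0) = (if x \<in> S then g x else 0)"
    using ae S by (auto simp: AE_restrict_space_iff elim!: AE_mp)
  ultimately have "(\<lambda>x. if x \<in> S then g x else 0) \<in> borel_measurable lebesgue"
    by (rule borel_measurable_AE)
  then show ?thesis
    using S by (simp add: borel_measurable_if)
qed

lemma integrable_lebesgue_on_AE:
  fixes f g :: "'a::euclidean_space \<Rightarrow> real"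
  assumes "S \<in> sets lebesgue" "integrable (lebesgue_on S) f" "AE x in lebesgue_on S. f x = g x"
  shows "integrable (lebesgue_on S) g"
  using assms integrable_cong_AE_imp[of "lebesgue_on S" f g]
    borel_measurable_lebesgue_on_AE[of S f g]
  by (auto simp: eq_commute)

section \<open>Linearity and uniqueness of weak gradients\<close>

lemma locally_integrable_lincomb:
  assumes "open \<Omega>" "locally_integrable \<Omega> v" "locally_integrable \<Omega> w"
    and ae: "AE x in lebesgue_on \<Omega>. z x = a * v x + b * w x"
  shows "locally_integrable \<Omega> z"
  unfolding locally_integrable_def
proof (intro allI impI, elim conjE)
  fix C assume C: "compact C" "C \<subseteq> \<Omega>"
  then have CL: "C \<in> sets lebesgue"
    by (intro sets_completionI_sets) (auto simp: borel_compact)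
  show "integrable (lebesgue_on C) z"
  proof (rule integrable_lebesgue_on_AE[OF CL])
    show "integrable (lebesgue_on C) (\<lambda>x. a * v x + b * w x)"
      using assms C by (auto simp: locally_integrable_def)
    have "AE x in lebesgue. x \<in> \<Omega> \<longrightarrow> z x = a * v x + b * w x"
      using ae \<open>open \<Omega>\<close> by (simp add: AE_restrict_space_iff)
    then show "AE x in lebesgue_on C. a * v x + b * w x = z x"
      using C CL by (auto simp: AE_restrict_space_iff elim!: AE_mp)
  qed
qed

lemma integrable_locally_integrable_mult:
  fixes v \<theta> :: "real^'n \<Rightarrow> real"
  assumes \<Omega>: "open \<Omega>" and v: "locally_integrable \<Omega> v" and \<theta>: "continuous_on UNIV \<theta>"
    and C: "compact C" "C \<subseteq> \<Omega>" and supp: "\<And>x. x \<notin> C \<Longrightarrow> \<theta> x = 0"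
  shows "integrable (lebesgue_on \<Omega>) (\<lambda>x. v x * \<theta> x)"
proof -
  have CL: "C \<in> sets lebesgue"
    using C by (intro sets_completionI_sets) (auto simp: borel_compact)
  have "compact (\<theta> ` C)"
    using C \<theta> by (auto intro: compact_continuous_image continuous_on_subset)
  then obtain B where B: "\<And>x. x \<in> C \<Longrightarrow> \<bar>\<theta> x\<bar> \<le> B"
    using compact_imp_bounded[of "\<theta> ` C"] by (auto simp: bounded_iff)
  have vC: "integrable lebesgue (\<lambda>x. indicator C x * v x)"
    using v C CL by (auto simp: locally_integrable_def simp flip: integrable_lebesgue_on_iff)
  have \<theta>_meas: "\<theta> \<in> borel_measurable lebesgue"
    using \<theta> by (intro measurable_completion) (auto intro: borel_measurable_continuous_onI)
  have "integrable lebesgue (\<lambda>x. (indicator C x * v x) * \<theta> x)"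
  proof (rule Bochner_Integration.integrable_bound)
    show "integrable lebesgue (\<lambda>x. B * (indicator C x * v x))"
      using vC by (intro integrable_mult_right)
    show "(\<lambda>x. (indicator C x * v x) * \<theta> x) \<in> borel_measurable lebesgue"
      by (intro borel_measurable_times[OF _ \<theta>_meas] borel_measurable_integrable vC)
    show "AE x in lebesgue. norm (indicator C x * v x * \<theta> x) \<le> norm (B * (indicator C x * v x))"
    proof (rule AE_I2)
      fix x
      show "norm (indicator C x * v x * \<theta> x) \<le> norm (B * (indicator C x * v x))"
        using B[of x] mult_right_mono[of "\<bar>\<theta> x\<bar>" "\<bar>B\<bar>" "\<bar>v x\<bar>"]
        by (auto simp: indicator_def abs_mult mult.commute)
    qed
  qed
  also have "(\<lambda>x. (indicator C x * v x) * \<theta> x) = (\<lambda>x. indicator \<Omega> x * (v x * \<theta> x))"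
    using C supp by (auto simp: indicator_def fun_eq_iff)
  finally show ?thesis
    using \<Omega> by (simp add: integrable_lebesgue_on_iff)
qed

lemma integrable_test_function:
  assumes \<Omega>: "open \<Omega>" and v: "locally_integrable \<Omega> v" and \<psi>: "test_function \<Omega> \<psi>"
  shows "integrable (lebesgue_on \<Omega>) (\<lambda>x. v x * \<psi> x)"
    and "integrable (lebesgue_on \<Omega>) (\<lambda>x. v x * frechet_derivative \<psi> (at x) (axis i 1))"
proof -
  let ?C = "closure {x. \<psi> x \<noteq> 0}"
  have C: "compact ?C" "?C \<subseteq> \<Omega>" and smooth: "C_k k \<psi>" for k
    using \<psi> by (auto simp: test_function_def)
  have outside: "\<psi> x = 0" if "x \<notin> ?C" for x
    using that closure_subset[of "{x. \<psi> x \<noteq> 0}"] by auto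
  show "integrable (lebesgue_on \<Omega>) (\<lambda>x. v x * \<psi> x)"
    using smooth[of 0] by (intro integrable_locally_integrable_mult[OF \<Omega> v _ C outside]) simp_all
  show "integrable (lebesgue_on \<Omega>) (\<lambda>x. v x * frechet_derivative \<psi> (at x) (axis i 1))"
  proof (rule integrable_locally_integrable_mult[OF \<Omega> v _ C])
    show "continuous_on UNIV (\<lambda>x. frechet_derivative \<psi> (at x) (axis i 1))"
      using smooth[of "Suc 0"] by simp
    show "frechet_derivative \<psi> (at x) (axis i 1) = 0" if "x \<notin> ?C" for x
    proof -
      have "(\<psi> has_derivative (\<lambda>_. 0)) (at x)"
      proof (rule has_derivative_transform_within_open[OF has_derivative_const])
        show "open (- ?C)" by (intro open_Compl closed_closure)
        show "x \<in> - ?C" using that by simp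
        show "0 = \<psi> y" if "y \<in> - ?C" for y
          using outside[of y] that by (metis ComplD)
      qed
      then show ?thesis
        by (simp add: frechet_derivative_at[symmetric])
    qed
  qed
qed

lemma has_weak_gradient_lincomb:
  assumes \<Omega>: "open \<Omega>" and v: "has_weak_gradient \<Omega> v g" and w: "has_weak_gradient \<Omega> w h"
    and ae: "AE x in lebesgue_on \<Omega>. z x = a * v x + b * w x"
  shows "has_weak_gradient \<Omega> z (\<lambda>x. a *\<^sub>R g x + b *\<^sub>R h x)"
proof -
  have lv: "locally_integrable \<Omega> v" "locally_integrable \<Omega> (\<lambda>x. g x $ i)"
    and lw: "locally_integrable \<Omega> w" "locally_integrable \<Omega> (\<lambda>x. h x $ i)" for i
    using v w by (auto simp: has_weak_gradient_def)
  have lz: "locally_integrable \<Omega> z"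
    by (rule locally_integrable_lincomb[OF \<Omega> lv(1) lw(1) ae])
  have "(\<integral>x. z x * frechet_derivative \<psi> (at x) (axis i 1) \<partial>lebesgue_on \<Omega>) =
      - (\<integral>x. (a *\<^sub>R g x + b *\<^sub>R h x) $ i * \<psi> x \<partial>lebesgue_on \<Omega>)"
    if \<psi>: "test_function \<Omega> \<psi>" for \<psi> i
  proof -
    let ?d = "\<lambda>x. frechet_derivative \<psi> (at x) (axis i 1)"
    note int = integrable_test_function[OF \<Omega> _ \<psi>]
    have "(\<integral>x. z x * ?d x \<partial>lebesgue_on \<Omega>)
        = (\<integral>x. a * (v x * ?d x) + b * (w x * ?d x) \<partial>lebesgue_on \<Omega>)"
    proof (rule integral_cong_AE)
      show "AE x in lebesgue_on \<Omega>. z x * ?d x = a * (v x * ?d x) + b * (w x * ?d x)"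
        using ae by (rule AE_mp) (auto simp: algebra_simps)
      show "(\<lambda>x. a * (v x * ?d x) + b * (w x * ?d x)) \<in> borel_measurable (lebesgue_on \<Omega>)"
        using int(2)[OF lv(1)] int(2)[OF lw(1)]
        by (intro borel_measurable_integrable Bochner_Integration.integrable_add integrable_mult_right)
    qed (use int(2)[OF lz] in \<open>rule borel_measurable_integrable\<close>)
    also have "\<dots> = a * (\<integral>x. v x * ?d x \<partial>lebesgue_on \<Omega>) + b * (\<integral>x. w x * ?d x \<partial>lebesgue_on \<Omega>)"
      using int(2)[OF lv(1)] int(2)[OF lw(1)] by simp
    also have "\<dots> = - (a * (\<integral>x. g x $ i * \<psi> x \<partial>lebesgue_on \<Omega>) + b * (\<integral>x. h x $ i * \<psi> x \<partial>lebesgue_on \<Omega>))"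
      using v w \<psi> by (simp add: has_weak_gradient_def)
    also have "\<dots> = - (\<integral>x. a * (g x $ i * \<psi> x) + b * (h x $ i * \<psi> x) \<partial>lebesgue_on \<Omega>)"
      using int(1)[OF lv(2)] int(1)[OF lw(2)] by simp
    also have "\<dots> = - (\<integral>x. (a *\<^sub>R g x + b *\<^sub>R h x) $ i * \<psi> x \<partial>lebesgue_on \<Omega>)"
      by (simp add: algebra_simps)
    finally show ?thesis .
  qed
  moreover have "locally_integrable \<Omega> (\<lambda>x. (a *\<^sub>R g x + b *\<^sub>R h x) $ i)" for i
    by (rule locally_integrable_lincomb[OF \<Omega> lv(2)[of i] lw(2)[of i], where a = a and b = b]) simp
  ultimately show ?thesis
    using lz by (simp add: has_weak_gradient_def)
qed

lemma has_weak_gradient_unique: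
  fixes g h :: "real^'n \<Rightarrow> real^'n"
  assumes \<Omega>: "open \<Omega>" and g: "has_weak_gradient \<Omega> v g" and h: "has_weak_gradient \<Omega> v h"
  shows "AE x in lebesgue_on \<Omega>. g x = h x"
proof -
  have lg: "locally_integrable \<Omega> (\<lambda>x. g x $ i)" and lh: "locally_integrable \<Omega> (\<lambda>x. h x $ i)" for i
    using g h by (auto simp: has_weak_gradient_def)
  have "AE x in lebesgue_on \<Omega>. g x $ i - h x $ i = 0" for i
  proof (rule fundamental_lemma_calculus_of_variations[OF \<Omega>])
    show "locally_integrable \<Omega> (\<lambda>x. g x $ i - h x $ i)"
      by (rule locally_integrable_lincomb[OF \<Omega> lg[of i] lh[of i], where a = 1 and b = "-1"]) simp
    show "(\<integral>x. (g x $ i - h x $ i) * \<psi> x \<partial>lebesgue_on \<Omega>) = 0" if \<psi>: "test_function \<Omega> \<psi>" for \<psi>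
      using g h \<psi> integrable_test_function(1)[OF \<Omega> lg \<psi>] integrable_test_function(1)[OF \<Omega> lh \<psi>]
      by (simp add: left_diff_distrib has_weak_gradient_def)
  qed
  then have "AE x in lebesgue_on \<Omega>. \<forall>i. g x $ i - h x $ i = 0"
    by (simp add: AE_all_countable)
  then show ?thesis
    by (rule AE_mp) (auto simp: vec_eq_iff)
qed

lemma has_weak_gradient_weak_gradient:
  "v \<in> H1 \<Omega> \<Longrightarrow> has_weak_gradient \<Omega> v (weak_gradient \<Omega> v)"
  unfolding weak_gradient_def by (rule someI_ex[of "has_weak_gradient \<Omega> v"]) (auto simp: H1_def)

lemma weak_gradient_AE_eq:
  assumes "open \<Omega>" "has_weak_gradient \<Omega> v g"
  shows "AE x in lebesgue_on \<Omega>. weak_gradient \<Omega> v x = g x"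
  unfolding weak_gradient_def
  using assms someI[of "has_weak_gradient \<Omega> v"] by (intro has_weak_gradient_unique)

text \<open>Membership in \<open>H1 \<Omega>\<close> only says that some weak gradient is square
  integrable; uniqueness passes this on to the chosen one.\<close>

lemma L2_fun_weak_gradient:
  assumes \<Omega>: "open \<Omega>" and v: "v \<in> H1 \<Omega>"
  shows "L2_fun \<Omega> (\<lambda>x. weak_gradient \<Omega> v x $ i)"
proof -
  obtain g where g: "has_weak_gradient \<Omega> v g" and L2: "L2_fun \<Omega> (\<lambda>x. g x $ i)"
    using v by (auto simp: H1_def)
  have ae: "AE x in lebesgue_on \<Omega>. g x $ i = weak_gradient \<Omega> v x $ i"
    using weak_gradient_AE_eq[OF \<Omega> g] by (rule AE_mp) auto
  moreover have "AE x in lebesgue_on \<Omega>. (g x $ i)\<^sup>2 = (weak_gradient \<Omega> v x $ i)\<^sup>2"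
    using ae by (rule AE_mp) auto
  ultimately show ?thesis
    using L2 \<Omega> unfolding L2_fun_def
    by (blast intro: borel_measurable_lebesgue_on_AE integrable_lebesgue_on_AE borel_open
        sets_completionI_sets lborelD)
qed

lemma weak_gradient_lincomb_AE:
  assumes \<Omega>: "open \<Omega>" and v: "v \<in> H1 \<Omega>" and w: "w \<in> H1 \<Omega>"
    and ae: "AE x in lebesgue_on \<Omega>. z x = a * v x + b * w x"
  shows "AE x in lebesgue_on \<Omega>. weak_gradient \<Omega> z x
    = a *\<^sub>R weak_gradient \<Omega> v x + b *\<^sub>R weak_gradient \<Omega> w x"
  by (intro weak_gradient_AE_eq[OF \<Omega>] has_weak_gradient_lincomb[OF \<Omega> _ _ ae]
      has_weak_gradient_weak_gradient v w)

section \<open>Quadratic estimates for the H1 norm\<close>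

lemma H1_norm_sq:
  "(H1_norm \<Omega> v)\<^sup>2 = (\<integral>x. (v x)\<^sup>2 \<partial>lebesgue_on \<Omega>)
     + (\<Sum>i\<in>UNIV. \<integral>x. (weak_gradient \<Omega> v x $ i)\<^sup>2 \<partial>lebesgue_on \<Omega>)"
  unfolding H1_norm_def by (intro real_sqrt_pow2 add_nonneg_nonneg sum_nonneg) auto

text \<open>Any pointwise quadratic inequality integrates. Leaving the coefficients free covers the
  triangle estimate with factors 2, convexity with weights 1 - t and t, and symmetry under negation,
  so that squared norms replace the Minkowski inequality throughout.\<close>

lemma L2_lincomb_bound:
  fixes v w z :: "real^'n \<Rightarrow> real"
  assumes \<Omega>: "open \<Omega>" and v: "L2_fun \<Omega> v" and w: "L2_fun \<Omega> w"
    and ae: "AE x in lebesgue_on \<Omega>. z x = a * v x + b * w x"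
    and quad: "\<And>s t. (a * s + b * t)\<^sup>2 \<le> \<alpha> * s\<^sup>2 + \<beta> * t\<^sup>2"
  shows "L2_fun \<Omega> z"
    and "(\<integral>x. (z x)\<^sup>2 \<partial>lebesgue_on \<Omega>)
      \<le> \<alpha> * (\<integral>x. (v x)\<^sup>2 \<partial>lebesgue_on \<Omega>) + \<beta> * (\<integral>x. (w x)\<^sup>2 \<partial>lebesgue_on \<Omega>)"
proof -
  let ?M = "lebesgue_on \<Omega>"
  have \<Omega>': "\<Omega> \<in> sets lebesgue" using \<Omega> by auto
  have [measurable]: "v \<in> borel_measurable ?M" "w \<in> borel_measurable ?M"
    and int: "integrable ?M (\<lambda>x. (v x)\<^sup>2)" "integrable ?M (\<lambda>x. (w x)\<^sup>2)"
    using v w by (auto simp: L2_fun_def)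
  have intr: "integrable ?M (\<lambda>x. \<alpha> * (v x)\<^sup>2 + \<beta> * (w x)\<^sup>2)"
    using int by simp
  have "integrable ?M (\<lambda>x. (a * v x + b * w x)\<^sup>2)"
    by (rule Bochner_Integration.integrable_bound[OF intr])
      (use quad in \<open>auto intro!: order_trans[OF _ abs_ge_self]\<close>)
  then have intz: "integrable ?M (\<lambda>x. (z x)\<^sup>2)"
    by (rule integrable_lebesgue_on_AE[OF \<Omega>']) (use ae in \<open>auto elim!: AE_mp\<close>)
  have "z \<in> borel_measurable ?M"
    by (rule borel_measurable_lebesgue_on_AE[OF \<Omega>', of "\<lambda>x. a * v x + b * w x"])
      (use ae in \<open>auto simp: eq_commute\<close>)
  then show "L2_fun \<Omega> z"
    using intz by (simp add: L2_fun_def)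
  have "(\<integral>x. (z x)\<^sup>2 \<partial>?M) \<le> (\<integral>x. \<alpha> * (v x)\<^sup>2 + \<beta> * (w x)\<^sup>2 \<partial>?M)"
    by (rule integral_mono_AE[OF intz intr]) (use ae quad in \<open>auto elim!: AE_mp\<close>)
  then show "(\<integral>x. (z x)\<^sup>2 \<partial>?M) \<le> \<alpha> * (\<integral>x. (v x)\<^sup>2 \<partial>?M) + \<beta> * (\<integral>x. (w x)\<^sup>2 \<partial>?M)"
    using int by simp
qed

lemma sum_square_le: "(1 * s + 1 * t)\<^sup>2 \<le> 2 * s\<^sup>2 + 2 * t\<^sup>2"
  and diff_square_le: "(1 * s + (- 1) * t)\<^sup>2 \<le> 2 * s\<^sup>2 + 2 * t\<^sup>2" for s t :: real
  using zero_le_power2[of "s - t"] zero_le_power2[of "s + t"]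
  by (simp_all add: power2_eq_square algebra_simps)

lemma H1_diff:
  assumes \<Omega>: "open \<Omega>" and v: "v \<in> H1 \<Omega>" and w: "w \<in> H1 \<Omega>"
  shows "(\<lambda>x. v x - w x) \<in> H1 \<Omega>"
proof -
  note v' = has_weak_gradient_weak_gradient[OF v] and w' = has_weak_gradient_weak_gradient[OF w]
  have "L2_fun \<Omega> (\<lambda>x. v x - w x)"
    by (rule L2_lincomb_bound(1)[OF \<Omega> _ _ _ diff_square_le, of v w]) (use v w in \<open>simp_all add: H1_def\<close>)
  moreover have "has_weak_gradient \<Omega> (\<lambda>x. v x - w x)
      (\<lambda>x. 1 *\<^sub>R weak_gradient \<Omega> v x + (- 1) *\<^sub>R weak_gradient \<Omega> w x)"
    by (rule has_weak_gradient_lincomb[OF \<Omega> v' w']) simp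
  moreover have "L2_fun \<Omega> (\<lambda>x. (1 *\<^sub>R weak_gradient \<Omega> v x + (- 1) *\<^sub>R weak_gradient \<Omega> w x) $ i)" for i
    by (rule L2_lincomb_bound(1)[OF \<Omega> L2_fun_weak_gradient[OF \<Omega> v, of i]
          L2_fun_weak_gradient[OF \<Omega> w, of i] _ diff_square_le]) simp
  ultimately show ?thesis
    unfolding H1_def by blast
qed

lemma H1_norm_lincomb_bound:
  assumes \<Omega>: "open \<Omega>" and v: "v \<in> H1 \<Omega>" and w: "w \<in> H1 \<Omega>"
    and ae: "AE x in lebesgue_on \<Omega>. z x = a * v x + b * w x"
    and quad: "\<And>s t. (a * s + b * t)\<^sup>2 \<le> \<alpha> * s\<^sup>2 + \<beta> * t\<^sup>2"
  shows "(H1_norm \<Omega> z)\<^sup>2 \<le> \<alpha> * (H1_norm \<Omega> v)\<^sup>2 + \<beta> * (H1_norm \<Omega> w)\<^sup>2"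
proof -
  have "(\<integral>x. (z x)\<^sup>2 \<partial>lebesgue_on \<Omega>)
      \<le> \<alpha> * (\<integral>x. (v x)\<^sup>2 \<partial>lebesgue_on \<Omega>) + \<beta> * (\<integral>x. (w x)\<^sup>2 \<partial>lebesgue_on \<Omega>)"
    using v w by (intro L2_lincomb_bound(2)[OF \<Omega> _ _ ae quad]) (auto simp: H1_def)
  moreover have "(\<integral>x. (weak_gradient \<Omega> z x $ i)\<^sup>2 \<partial>lebesgue_on \<Omega>)
      \<le> \<alpha> * (\<integral>x. (weak_gradient \<Omega> v x $ i)\<^sup>2 \<partial>lebesgue_on \<Omega>)
        + \<beta> * (\<integral>x. (weak_gradient \<Omega> w x $ i)\<^sup>2 \<partial>lebesgue_on \<Omega>)" for i
    using weak_gradient_lincomb_AE[OF \<Omega> v w ae]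
    by (intro L2_lincomb_bound(2)[OF \<Omega> _ _ _ quad] L2_fun_weak_gradient[OF \<Omega>] v w)
      (auto elim!: AE_mp)
  then have "(\<Sum>i\<in>UNIV. \<integral>x. (weak_gradient \<Omega> z x $ i)\<^sup>2 \<partial>lebesgue_on \<Omega>)
      \<le> \<alpha> * (\<Sum>i\<in>UNIV. \<integral>x. (weak_gradient \<Omega> v x $ i)\<^sup>2 \<partial>lebesgue_on \<Omega>)
        + \<beta> * (\<Sum>i\<in>UNIV. \<integral>x. (weak_gradient \<Omega> w x $ i)\<^sup>2 \<partial>lebesgue_on \<Omega>)"
    by (simp add: sum_distrib_left sum.distrib[symmetric] sum_mono)
  ultimately show ?thesis
    unfolding H1_norm_sq by (simp add: distrib_left)
qed

lemma grad_sq_nonneg: "0 \<le> grad_sq \<Omega> v x"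
  unfolding grad_sq_def by (intro sum_nonneg) auto

lemma grad_sq_eq_0_iff: "grad_sq \<Omega> v x = 0 \<longleftrightarrow> weak_gradient \<Omega> v x = 0"
  unfolding grad_sq_def by (subst sum_nonneg_eq_0_iff) (auto simp: vec_eq_iff)

lemma integrable_grad_sq:
  assumes "open \<Omega>" "v \<in> H1 \<Omega>"
  shows "integrable (lebesgue_on \<Omega>) (grad_sq \<Omega> v)"
  using L2_fun_weak_gradient[OF assms] unfolding grad_sq_def by (auto simp: L2_fun_def)

text \<open>With r = s - t one has s^2 - t^2 = r^2 + 2 r t, and Young's inequality bounds |2 r t| by
  r^2/\<delta> + \<delta> t^2. The small factor falls on \<open>w\<close>, which will be the fixed
  accumulation point, while the large factor 1/\<delta> falls on the H1 distance, which can be made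
  small afterwards.\<close>

lemma L1_norm_grad_sq_diff:
  assumes \<Omega>: "open \<Omega>" and v: "v \<in> H1 \<Omega>" and w: "w \<in> H1 \<Omega>" and z: "z \<in> H1 \<Omega>"
    and ae: "AE x in lebesgue_on \<Omega>. z x = v x - w x" and \<delta>: "0 < \<delta>"
  shows "L1_norm \<Omega> (\<lambda>x. grad_sq \<Omega> v x - grad_sq \<Omega> w x)
    \<le> (1 + 1 / \<delta>) * (H1_norm \<Omega> z)\<^sup>2 + \<delta> * L1_norm \<Omega> (grad_sq \<Omega> w)"
proof -
  let ?M = "lebesgue_on \<Omega>"
  have sq: "\<bar>s\<^sup>2 - t\<^sup>2\<bar> \<le> (1 + 1 / \<delta>) * (s - t)\<^sup>2 + \<delta> * t\<^sup>2" for s t :: real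
  proof -
    define r where "r = s - t"
    have "0 \<le> (r - \<delta> * t)\<^sup>2 / \<delta>" "0 \<le> (r + \<delta> * t)\<^sup>2 / \<delta>"
      using \<delta> by auto
    moreover have "(r - \<delta> * t)\<^sup>2 / \<delta> = r\<^sup>2 / \<delta> - 2 * r * t + \<delta> * t\<^sup>2"
      "(r + \<delta> * t)\<^sup>2 / \<delta> = r\<^sup>2 / \<delta> + 2 * r * t + \<delta> * t\<^sup>2"
      using \<delta> by (simp_all add: field_simps power2_eq_square)
    moreover have "s\<^sup>2 - t\<^sup>2 = r\<^sup>2 + 2 * r * t" "(1 + 1 / \<delta>) * r\<^sup>2 = r\<^sup>2 + r\<^sup>2 / \<delta>"
      by (simp_all add: r_def distrib_right) (simp add: algebra_simps power2_eq_square)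
    ultimately show ?thesis
      using zero_le_power2[of r] unfolding r_def[symmetric] abs_le_iff by linarith
  qed
  note int = integrable_grad_sq[OF \<Omega> v] integrable_grad_sq[OF \<Omega> w] integrable_grad_sq[OF \<Omega> z]
  have "AE x in ?M. weak_gradient \<Omega> z x = weak_gradient \<Omega> v x - weak_gradient \<Omega> w x"
    using weak_gradient_lincomb_AE[OF \<Omega> v w, of z 1 "-1"] ae by simp
  then have "AE x in ?M. \<bar>grad_sq \<Omega> v x - grad_sq \<Omega> w x\<bar>
      \<le> (1 + 1 / \<delta>) * grad_sq \<Omega> z x + \<delta> * grad_sq \<Omega> w x"
  proof (rule AE_mp, intro AE_I2 impI)
    fix x assume eq: "weak_gradient \<Omega> z x = weak_gradient \<Omega> v x - weak_gradient \<Omega> w x"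
    have "\<bar>grad_sq \<Omega> v x - grad_sq \<Omega> w x\<bar>
        \<le> (\<Sum>i\<in>UNIV. \<bar>(weak_gradient \<Omega> v x $ i)\<^sup>2 - (weak_gradient \<Omega> w x $ i)\<^sup>2\<bar>)"
      unfolding grad_sq_def sum_subtractf[symmetric] by (rule sum_abs)
    also have "\<dots> \<le> (\<Sum>i\<in>UNIV. (1 + 1 / \<delta>) * (weak_gradient \<Omega> z x $ i)\<^sup>2
        + \<delta> * (weak_gradient \<Omega> w x $ i)\<^sup>2)"
      unfolding eq vector_minus_component by (intro sum_mono sq)
    also have "\<dots> = (1 + 1 / \<delta>) * grad_sq \<Omega> z x + \<delta> * grad_sq \<Omega> w x"
      by (simp add: grad_sq_def sum.distrib sum_distrib_left)
    finally show "\<bar>grad_sq \<Omega> v x - grad_sq \<Omega> w x\<bar>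
      \<le> (1 + 1 / \<delta>) * grad_sq \<Omega> z x + \<delta> * grad_sq \<Omega> w x" .
  qed
  then have "L1_norm \<Omega> (\<lambda>x. grad_sq \<Omega> v x - grad_sq \<Omega> w x)
      \<le> (\<integral>x. (1 + 1 / \<delta>) * grad_sq \<Omega> z x + \<delta> * grad_sq \<Omega> w x \<partial>?M)"
    unfolding L1_norm_def using int by (intro integral_mono_AE) auto
  also have "\<dots> = (1 + 1 / \<delta>) * (\<integral>x. grad_sq \<Omega> z x \<partial>?M) + \<delta> * L1_norm \<Omega> (grad_sq \<Omega> w)"
    using int by (simp add: L1_norm_def grad_sq_nonneg)
  also have "(\<integral>x. grad_sq \<Omega> z x \<partial>?M) \<le> (H1_norm \<Omega> z)\<^sup>2"
    unfolding H1_norm_sq grad_sq_def using L2_fun_weak_gradient[OF \<Omega> z]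
    by (subst Bochner_Integration.integral_sum) (auto simp: L2_fun_def)
  finally show ?thesis
    using \<delta> by (simp add: mult_left_mono)
qed

section \<open>Separation of convex sets\<close>

definition sublinear :: "('a::real_vector \<Rightarrow> real) \<Rightarrow> bool" where
  "sublinear q \<longleftrightarrow> (\<forall>x y. q (x + y) \<le> q x + q y) \<and> (\<forall>c x. 0 \<le> c \<longrightarrow> q (c *\<^sub>R x) = c * q x)"

lemma sublinear_add: "sublinear q \<Longrightarrow> q (x + y) \<le> q x + q y"
  and sublinear_scale: "sublinear q \<Longrightarrow> 0 \<le> c \<Longrightarrow> q (c *\<^sub>R x) = c * q x"
  by (auto simp: sublinear_def)

lemma sublinear_0: "sublinear q \<Longrightarrow> q 0 = 0"
  using sublinear_scale[of q 0 0] by simp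

lemma sublinear_minus_le: "sublinear q \<Longrightarrow> - q (- x) \<le> q x"
  using sublinear_add[of q x "- x"] sublinear_0[of q] by simp

text \<open>Infima yield only the inequality for positive factors; applied to
  \<open>inverse c\<close> it also gives the converse.\<close>

lemma sublinearI:
  fixes q :: "'a::real_vector \<Rightarrow> real"
  assumes add: "\<And>x y. q (x + y) \<le> q x + q y"
    and scale: "\<And>c x. 0 < c \<Longrightarrow> q (c *\<^sub>R x) \<le> c * q x" and "q 0 = 0"
  shows "sublinear q"
  unfolding sublinear_def
proof (intro conjI allI impI add)
  fix c :: real and x
  assume "0 \<le> c"
  then consider "c = 0" | "0 < c" by linarith
  then show "q (c *\<^sub>R x) = c * q x"
  proof cases
    case 2
    have "q x \<le> inverse c * q (c *\<^sub>R x)"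
      using scale[of "inverse c" "c *\<^sub>R x"] 2 by simp
    then have "c * q x \<le> q (c *\<^sub>R x)"
      using 2 by (simp add: field_simps)
    then show ?thesis
      using scale[OF 2, of x] by simp
  qed (use \<open>q 0 = 0\<close> in simp)
qed

text \<open>The common pattern of three later infima: over a chain, over t \<ge> 0, and over pairs
  (t, c). Each hypothesis asks only for one index that undercuts a given sum or multiple.\<close>

lemma sublinear_INF:
  fixes p :: "'i \<Rightarrow> 'a::real_vector \<Rightarrow> real"
  assumes ne: "I \<noteq> {}" and bdd: "\<And>x. bdd_below ((\<lambda>i. p i x) ` I)"
    and zero: "(INF i\<in>I. p i 0) = 0"
    and add: "\<And>i k x y. i \<in> I \<Longrightarrow> k \<in> I \<Longrightarrow> \<exists>l\<in>I. p l (x + y) \<le> p i x + p k y"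
    and scale: "\<And>i c x. i \<in> I \<Longrightarrow> 0 < c \<Longrightarrow> \<exists>l\<in>I. p l (c *\<^sub>R x) \<le> c * p i x"
  shows "sublinear (\<lambda>x. INF i\<in>I. p i x)"
proof (rule sublinearI)
  let ?q = "\<lambda>x. INF i\<in>I. p i x"
  have lower: "?q x \<le> p i x" if "i \<in> I" for i x
    using bdd that by (rule cINF_lower)
  show "?q (x + y) \<le> ?q x + ?q y" for x y
  proof -
    have sum_le: "?q (x + y) \<le> p i x + p k y" if ik: "i \<in> I" "k \<in> I" for i k
    proof -
      obtain l where "l \<in> I" "p l (x + y) \<le> p i x + p k y"
        using add[OF ik] by blast
      then show ?thesis using lower[of l "x + y"] by linarith
    qed
    have "?q (x + y) - p k y \<le> ?q x" if "k \<in> I" for k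
      using sum_le that by (intro cINF_greatest[OF ne]) (auto simp: algebra_simps)
    then have "?q (x + y) - ?q x \<le> ?q y"
      by (intro cINF_greatest[OF ne]) (auto simp: algebra_simps)
    then show ?thesis by simp
  qed
  show "?q (c *\<^sub>R x) \<le> c * ?q x" if c: "0 < c" for c x
  proof -
    have "?q (c *\<^sub>R x) / c \<le> p i x" if i: "i \<in> I" for i
    proof -
      obtain l where "l \<in> I" "p l (c *\<^sub>R x) \<le> c * p i x"
        using scale[OF i c] by blast
      then have "?q (c *\<^sub>R x) \<le> c * p i x"
        using lower[of l "c *\<^sub>R x"] by linarith
      then show ?thesis using c by (simp add: field_simps)
    qed
    then have "?q (c *\<^sub>R x) / c \<le> ?q x"
      by (intro cINF_greatest[OF ne])
    then show ?thesis using c by (simp add: field_simps)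
  qed
qed (rule zero)

text \<open>Zorn's lemma for the reversed pointwise order, in which a chain is bounded by its
  infimum. The infimum is finite because every sublinear m \<le> q satisfies m x \<ge> - m (- x)
  \<ge> - q (- x).\<close>

lemma minimal_sublinear_exists:
  fixes q :: "'a::real_vector \<Rightarrow> real"
  assumes q: "sublinear q"
  shows "\<exists>m. sublinear m \<and> (\<forall>x. m x \<le> q x) \<and>
    (\<forall>r. sublinear r \<and> (\<forall>x. r x \<le> m x) \<longrightarrow> r = m)"
proof -
  let ?A = "{m. sublinear m \<and> (\<forall>x. m x \<le> q x)}"
  let ?P = "\<lambda>m r :: 'a \<Rightarrow> real. \<forall>x. r x \<le> m x"
  have "\<exists>m\<in>?A. \<forall>a\<in>?A. ?P m a \<longrightarrow> a = m"
  proof (rule predicate_Zorn)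
    show "partial_order_on ?A (relation_of ?P ?A)"
      by (rule partial_order_on_relation_ofI) (auto intro: order_trans simp: fun_eq_iff antisym)
    fix C assume C: "C \<in> Chains (relation_of ?P ?A)"
    then have CA: "C \<subseteq> ?A"
      by (auto simp: Chains_def relation_of_def)
    show "\<exists>u\<in>?A. \<forall>a\<in>C. ?P a u"
    proof (cases "C = {}")
      case True
      then show ?thesis using q by auto
    next
      case False
      have bdd: "bdd_below ((\<lambda>m. m x) ` C)" for x
      proof (rule bdd_belowI2)
        fix m assume "m \<in> C"
        then have "sublinear m" "m (- x) \<le> q (- x)" using CA by auto
        then show "- q (- x) \<le> m x"
          using sublinear_minus_le[of m x] by linarith
      qed
      have "sublinear (\<lambda>x. INF m\<in>C. m x)"
      proof (rule sublinear_INF[OF False bdd])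
        have "(\<lambda>m. m 0) ` C = {0}"
          using False CA sublinear_0 by force
        then show "(INF m\<in>C. m 0) = 0" by simp
        show "\<exists>l\<in>C. l (x + y) \<le> i x + k y" if ik: "i \<in> C" "k \<in> C" for i k x y
        proof -
          have sub: "sublinear i" "sublinear k" using ik CA by auto
          have "?P i k \<or> ?P k i"
            using C ik by (auto simp: Chains_def relation_of_def)
          then show ?thesis
          proof
            assume "?P i k"
            then show ?thesis
              using sublinear_add[OF sub(2), of x y] ik(2) by (smt (verit))
          next
            assume "?P k i"
            then show ?thesis
              using sublinear_add[OF sub(1), of x y] ik(1) by (smt (verit))
          qed
        qed
        show "\<exists>l\<in>C. l (c *\<^sub>R x) \<le> c * i x" if "i \<in> C" "0 < c" for i c x
          using that CA sublinear_scale[of i c x] by (intro bexI[of _ i]) auto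
      qed
      moreover have lower: "(INF m\<in>C. m x) \<le> m x" if "m \<in> C" for m x
        using bdd that by (rule cINF_lower)
      moreover have "(INF m\<in>C. m x) \<le> q x" for x
        using False CA lower[of _ x] by (blast intro: order_trans)
      ultimately show ?thesis
        by (intro bexI[of _ "\<lambda>x. INF m\<in>C. m x"]) auto
    qed
  qed
  then obtain m where m: "m \<in> ?A" and min: "\<And>a. a \<in> ?A \<Longrightarrow> ?P m a \<Longrightarrow> a = m"
    by blast
  have "r = m" if "sublinear r \<and> (\<forall>x. r x \<le> m x)" for r
    using that m by (intro min) (auto intro: order_trans)
  then show ?thesis
    using m by blast
qed

text \<open>
  Minimality is tested against \<open>x \<mapsto> inf\<^sub>t\<^sub>\<ge>\<^sub>0 (q (x + t y) - t q y)\<close>, which is sublinear and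
  bounded by \<open>q\<close>; equality with \<open>q\<close> gives \<open>q x + q y \<le> q (x + y)\<close>.
\<close>

lemma minimal_sublinear_additive:
  fixes q :: "'a::real_vector \<Rightarrow> real"
  assumes q: "sublinear q" and min: "\<And>r. sublinear r \<Longrightarrow> (\<And>x. r x \<le> q x) \<Longrightarrow> r = q"
  shows "q (x + y) = q x + q y"
proof -
  let ?p = "\<lambda>t z. q (z + t *\<^sub>R y) - t * q y"
  let ?r = "\<lambda>z. INF t\<in>{0..}. ?p t z"
  have low: "- q (- z) \<le> ?p t z" if "0 \<le> t" for t z
    using sublinear_add[OF q, of "z + t *\<^sub>R y" "- z"] sublinear_scale[OF q that, of y] by simp
  have bdd: "bdd_below ((\<lambda>t. ?p t z) ` {0..})" for z
    by (rule bdd_belowI2[of _ "- q (- z)"]) (use low in auto)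
  have lower: "?r z \<le> ?p t z" if "0 \<le> t" for t z
    using bdd that by (intro cINF_lower) auto
  have r_le: "?r z \<le> q z" for z
    using lower[of 0 z] by simp
  have "sublinear ?r"
  proof (rule sublinear_INF[OF _ bdd])
    have "?p t 0 = 0" if "0 \<le> t" for t
      using sublinear_scale[OF q that, of y] by simp
    then have "(\<lambda>t. ?p t 0) ` {0..} = {0}" by force
    then show "?r 0 = 0" by simp
    show "\<exists>l\<in>{0..}. ?p l (a + b) \<le> ?p s a + ?p t b" if "s \<in> {0..}" "t \<in> {0..}" for s t a b
      using that sublinear_add[OF q, of "a + s *\<^sub>R y" "b + t *\<^sub>R y"]
      by (intro bexI[of _ "s + t"]) (auto simp: algebra_simps)
    show "\<exists>l\<in>{0..}. ?p l (c *\<^sub>R a) \<le> c * ?p t a" if "t \<in> {0..}" "0 < c" for t c a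
      using that sublinear_scale[OF q, of c "a + t *\<^sub>R y"]
      by (intro bexI[of _ "c * t"]) (auto simp: algebra_simps)
  qed simp
  then have "?r = q"
    by (rule min) (rule r_le)
  then have "q x = ?r x"
    by (rule fun_cong[symmetric])
  also have "\<dots> \<le> ?p 1 x"
    by (rule lower) simp
  finally have "q x \<le> ?p 1 x" .
  then show ?thesis
    using sublinear_add[OF q, of x y] by simp
qed

text \<open>Hahn-Banach without extending from a subspace: a minimal sublinear functional is
  additive, hence odd, and oddness extends homogeneity to negative scalars.\<close>

lemma linear_below_sublinear_exists:
  fixes q :: "'a::real_vector \<Rightarrow> real"
  assumes "sublinear q"
  shows "\<exists>l. linear l \<and> (\<forall>x. l x \<le> q x)"
proof -
  obtain l where l: "sublinear l" "\<And>x. l x \<le> q x"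
    and min: "\<And>r. sublinear r \<Longrightarrow> (\<And>x. r x \<le> l x) \<Longrightarrow> r = l"
    using minimal_sublinear_exists[OF assms] by blast
  have add: "l (x + y) = l x + l y" for x y
    by (rule minimal_sublinear_additive[OF l(1) min])
  have neg: "l (- x) = - l x" for x
    using add[of x "- x"] sublinear_0[OF l(1)] by simp
  have "l (c *\<^sub>R x) = c *\<^sub>R l x" for c x
  proof (cases "0 \<le> c")
    case False
    then have "l ((- c) *\<^sub>R x) = - c * l x"
      by (intro sublinear_scale[OF l(1)]) simp
    then show ?thesis using neg[of "c *\<^sub>R x"] by simp
  qed (simp add: sublinear_scale[OF l(1)])
  then have "linear l"
    using add by (intro linearI)
  then show ?thesis using l(2) by blast
qed

text \<open>
  The functional is chosen below \<open>z \<mapsto> inf {\<parallel>z + t c\<parallel> - t d | t \<ge> 0, c \<in> C}\<close>, which is sublinear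
  by convexity of \<open>C\<close>, lies below the norm, and is at most \<open>- d\<close> at \<open>- c\<close>.
\<close>

lemma convex_separation_from_0:
  fixes C :: "'a::real_normed_vector set"
  assumes C: "convex C" and d: "0 < d" and dist: "\<And>c. c \<in> C \<Longrightarrow> d \<le> norm c"
  shows "\<exists>g :: 'a \<Rightarrow>\<^sub>L real. \<forall>c\<in>C. d \<le> blinfun_apply g c"
proof (cases "C = {}")
  case False
  let ?p = "\<lambda>(t, c) z. norm (z + t *\<^sub>R c) - t * d"
  let ?I = "{0::real..} \<times> C"
  let ?q = "\<lambda>z. INF i\<in>?I. ?p i z"
  have low: "- norm z \<le> ?p i z" if "i \<in> ?I" for i z
  proof -
    obtain t c where i: "i = (t, c)" "0 \<le> t" "c \<in> C" using \<open>i \<in> ?I\<close> by auto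
    have "t * d \<le> norm (t *\<^sub>R c)"
      using dist[OF i(3)] i(2) by (simp add: mult_left_mono)
    also have "\<dots> \<le> norm (z + t *\<^sub>R c) + norm z"
      using norm_triangle_ineq4[of "z + t *\<^sub>R c" z] by simp
    finally show ?thesis using i by simp
  qed
  have bdd: "bdd_below ((\<lambda>i. ?p i z) ` ?I)" for z
    by (rule bdd_belowI2[of _ "- norm z"]) (rule low)
  have lower: "?q z \<le> ?p i z" if "i \<in> ?I" for i z
    using bdd that by (rule cINF_lower)
  obtain c0 where c0: "c0 \<in> C" using False by blast
  then have "(0, c0) \<in> ?I" by simp
  then have I_ne: "?I \<noteq> {}" by blast
  have q_le: "?q z \<le> norm z" for z
    using lower[of "(0, c0)" z] c0 by simp
  have "sublinear ?q"
  proof (rule sublinear_INF[OF _ bdd])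
    show "?I \<noteq> {}" by (rule I_ne)
    have "0 \<le> ?q 0"
    proof (rule cINF_greatest)
      show "?I \<noteq> {}" by (rule I_ne)
    qed (use low[of _ 0] in force)
    then show "?q 0 = 0" using q_le[of 0] by simp
    show "\<exists>l\<in>?I. ?p l (x + y) \<le> ?p i x + ?p k y" if "i \<in> ?I" "k \<in> ?I" for i k x y
    proof -
      obtain s a t b where i: "i = (s, a)" "0 \<le> s" "a \<in> C" and k: "k = (t, b)" "0 \<le> t" "b \<in> C"
        using \<open>i \<in> ?I\<close> \<open>k \<in> ?I\<close> by auto
      \<comment> \<open>Convexity merges the two directions into the weighted mean with weights s/(s
        + t) and t/(s + t); for s = t = 0 any point of \<open>C\<close> will do.\<close>
      obtain e where e: "e \<in> C" "(s + t) *\<^sub>R e = s *\<^sub>R a + t *\<^sub>R b"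
      proof (cases "s + t = 0")
        case True
        then have "s = 0" "t = 0" using i k by auto
        then show ?thesis using that[of a] i by simp
      next
        case False
        let ?e = "(s / (s + t)) *\<^sub>R a + (t / (s + t)) *\<^sub>R b"
        have "?e \<in> C"
          using i k False by (intro convexD[OF C]) (auto simp: add_divide_distrib[symmetric])
        then show ?thesis using that[of ?e] False by (simp add: scaleR_right_distrib)
      qed
      have "norm ((x + y) + (s + t) *\<^sub>R e) \<le> norm (x + s *\<^sub>R a) + norm (y + t *\<^sub>R b)"
        unfolding e(2) using norm_triangle_ineq[of "x + s *\<^sub>R a" "y + t *\<^sub>R b"]
        by (simp add: algebra_simps)
      then show ?thesis
        using i k e(1) by (intro bexI[of _ "(s + t, e)"]) (auto simp: algebra_simps)
    qed
    show "\<exists>l\<in>?I. ?p l (r *\<^sub>R x) \<le> r * ?p i x" if "i \<in> ?I" "0 < r" for i r x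
    proof -
      obtain t c where i: "i = (t, c)" "0 \<le> t" "c \<in> C" using \<open>i \<in> ?I\<close> by auto
      have "norm (r *\<^sub>R x + (r * t) *\<^sub>R c) = r * norm (x + t *\<^sub>R c)"
        using norm_scaleR[of r "x + t *\<^sub>R c"] \<open>0 < r\<close> by (simp add: scaleR_right_distrib)
      then show ?thesis
        using i \<open>0 < r\<close> by (intro bexI[of _ "(r * t, c)"]) (auto simp: algebra_simps)
    qed
  qed
  then obtain l where l: "linear l" "\<And>z. l z \<le> ?q z"
    using linear_below_sublinear_exists by blast
  have "l z \<le> norm z" for z
    using l(2)[of z] q_le[of z] by linarith
  \<comment> \<open>Using the bound at both z and - z gives continuity, which turns the algebraic
    functional into an element of the dual space.\<close>
  then have "\<bar>l z\<bar> \<le> norm z * 1" for z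
    using linear_neg[OF l(1), of z] by (smt (verit) norm_minus_cancel mult_1_right)
  then have "bounded_linear l"
    using l(1) by (intro linear_conv_bounded_linear[THEN iffD1] bounded_linear_intro[of _ 1])
      (auto simp: linear_add linear_scale)
  moreover have "d \<le> l c" if "c \<in> C" for c
    using l(2)[of "- c"] lower[of "(1, c)" "- c"] that linear_neg[OF l(1), of c] by simp
  ultimately show ?thesis
    by (intro exI[of _ "Blinfun l"]) (simp add: bounded_linear_Blinfun_apply)
qed simp

text \<open>The neighbourhood is an open half-space around \<open>x\<close>. A positive distance is
  assumed instead of closedness because for the H1 balls the distance is what the estimates
  deliver.\<close>

lemma convex_separation_weak_neighbourhood:
  fixes C :: "'a::real_normed_vector set"
  assumes C: "convex C" and d: "0 < d" and dist: "\<And>c. c \<in> C \<Longrightarrow> d \<le> norm (c - x)"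
  shows "\<exists>V. openin weak_topology V \<and> x \<in> V \<and> V \<inter> C = {}"
proof -
  have "convex ((\<lambda>c. c - x) ` C)"
    using convex_translation[OF C, of "- x"] by simp
  then obtain g :: "'a \<Rightarrow>\<^sub>L real" where g: "\<And>c. c \<in> C \<Longrightarrow> d \<le> g (c - x)"
    using convex_separation_from_0[of "(\<lambda>c. c - x) ` C" d] d dist by auto
  let ?V = "blinfun_apply g -` {..<g x + d}"
  have "openin weak_topology ?V"
    unfolding weak_topology_def openin_topology_generated_by_iff
    by (rule generate_topology_on.Basis) (blast intro: open_lessThan)
  moreover have "c \<notin> ?V" if "c \<in> C" for c
    using g[OF that] by (simp add: blinfun.diff_right)
  ultimately show ?thesis
    using d by (intro exI[of _ ?V]) auto
qed

text \<open>Mazur's theorem in neighbourhood form: a point outside has a weak neighbourhood that no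
  term of the sequence enters.\<close>

lemma weak_accumulation_point_in_closed_convex:
  fixes s :: "nat \<Rightarrow> 'a::real_normed_vector"
  assumes x: "weak_accumulation_point x s" and C: "convex C" "closed C" and s: "\<And>n. s n \<in> C"
  shows "x \<in> C"
proof (rule ccontr)
  assume "x \<notin> C"
  then obtain d where "0 < d" "ball x d \<subseteq> - C"
    using C(2) open_contains_ball[of "- C"] by blast
  then have "d \<le> dist x c" if "c \<in> C" for c
    using that by (force simp: subset_iff)
  then obtain V where "openin weak_topology V" "x \<in> V" "V \<inter> C = {}"
    using convex_separation_weak_neighbourhood[OF C(1) \<open>0 < d\<close>, of x] by (auto simp: dist_norm norm_minus_commute)
  then have "\<exists>\<^sub>F n in sequentially. s n \<in> V" "\<And>n. s n \<notin> V"
    using x s by (auto simp: weak_accumulation_point_def)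
  then show False
    by (simp add: frequently_def)
qed

section \<open>The penalty\<close>

lemma integrable_lebesgue_on_subset:
  fixes w :: "'a::euclidean_space \<Rightarrow> real"
  assumes w: "integrable (lebesgue_on S) w" and A: "A \<in> sets lebesgue" "A \<subseteq> S" and S: "S \<in> sets lebesgue"
  shows "integrable (lebesgue_on A) w"
proof -
  have "integrable lebesgue (\<lambda>x. indicator A x * (indicator S x * w x))"
    using w S A integrable_mult_indicator[of A lebesgue "\<lambda>x. indicator S x * w x"]
    by (simp add: integrable_lebesgue_on_iff)
  also have "(\<lambda>x. indicator A x * (indicator S x * w x)) = (\<lambda>x. indicator A x * w x)"
    using A by (auto simp: indicator_def fun_eq_iff)
  finally show ?thesis
    using A by (simp add: integrable_lebesgue_on_iff)
qed

lemma L1_norm_split: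
  assumes w: "integrable (lebesgue_on S) w" and A: "A \<in> sets lebesgue" "A \<subseteq> S" and S: "S \<in> sets lebesgue"
  shows "L1_norm S w = L1_norm A w + L1_norm (S - A) w"
proof -
  have SA: "S - A \<in> sets lebesgue" using A S by auto
  have int: "integrable lebesgue (\<lambda>x. indicator A x * \<bar>w x\<bar>)"
    "integrable lebesgue (\<lambda>x. indicator (S - A) x * \<bar>w x\<bar>)"
    using integrable_lebesgue_on_subset[OF w A S] integrable_lebesgue_on_subset[OF w SA _ S] A SA
    by (auto simp flip: integrable_lebesgue_on_iff)
  have "L1_norm S w = (\<integral>x. indicator A x * \<bar>w x\<bar> + indicator (S - A) x * \<bar>w x\<bar> \<partial>lebesgue)"
    unfolding L1_norm_def integral_lebesgue_on_eq[OF S]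
    using A by (intro Bochner_Integration.integral_cong) (auto simp: indicator_def)
  also have "\<dots> = L1_norm A w + L1_norm (S - A) w"
    unfolding L1_norm_def integral_lebesgue_on_eq[OF A(1)] integral_lebesgue_on_eq[OF SA]
    by (rule Bochner_Integration.integral_add[OF int])
  finally show ?thesis .
qed

lemma L1_norm_nonneg: "0 \<le> L1_norm S w"
  unfolding L1_norm_def by simp

lemma L1_norm_mono:
  assumes "integrable (lebesgue_on S) w" "A \<in> sets lebesgue" "A \<subseteq> S" "S \<in> sets lebesgue"
  shows "L1_norm A w \<le> L1_norm S w"
  using L1_norm_split[OF assms] L1_norm_nonneg[of "S - A" w] by simp

lemma L1_norm_triangle:
  assumes "integrable (lebesgue_on S) v" "integrable (lebesgue_on S) w"
  shows "L1_norm S v \<le> L1_norm S w + L1_norm S (\<lambda>x. v x - w x)"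
proof -
  have "L1_norm S v \<le> (\<integral>x. \<bar>w x\<bar> + \<bar>v x - w x\<bar> \<partial>lebesgue_on S)"
    unfolding L1_norm_def using assms by (intro integral_mono) auto
  also have "\<dots> = L1_norm S w + L1_norm S (\<lambda>x. v x - w x)"
    unfolding L1_norm_def using assms by simp
  finally show ?thesis .
qed

lemma largest_K_norm_L1_norm:
  "largest_K_norm \<Omega> K w =
    (SUP A\<in>{A \<in> sets lebesgue. A \<subseteq> \<Omega> \<and> emeasure lebesgue A \<le> ennreal K}. L1_norm A w)"
  unfolding largest_K_norm_def L1_norm_def ..

text \<open>A real supremum dominates its members only when the family is bounded above;
  integrability over \<open>\<Omega>\<close> supplies the bound.\<close>

lemma L1_norm_le_largest_K_norm:
  assumes \<Omega>: "\<Omega> \<in> sets lebesgue" and w: "integrable (lebesgue_on \<Omega>) w"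
    and A: "A \<in> sets lebesgue" "A \<subseteq> \<Omega>" "emeasure lebesgue A \<le> ennreal K"
  shows "L1_norm A w \<le> largest_K_norm \<Omega> K w"
  unfolding largest_K_norm_L1_norm
proof (rule cSUP_upper)
  show "bdd_above ((\<lambda>A. L1_norm A w) ` {A \<in> sets lebesgue. A \<subseteq> \<Omega> \<and> emeasure lebesgue A \<le> ennreal K})"
    by (rule bdd_aboveI2[of _ _ "L1_norm \<Omega> w"]) (use w \<Omega> in \<open>auto intro: L1_norm_mono\<close>)
qed (use A in auto)

lemma largest_K_norm_leI:
  assumes "\<And>A. A \<in> sets lebesgue \<Longrightarrow> A \<subseteq> \<Omega> \<Longrightarrow> emeasure lebesgue A \<le> ennreal K \<Longrightarrow> L1_norm A w \<le> c"
  shows "largest_K_norm \<Omega> K w \<le> c"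
  unfolding largest_K_norm_L1_norm
proof (rule cSUP_least)
  have "{} \<in> {A \<in> sets lebesgue. A \<subseteq> \<Omega> \<and> emeasure lebesgue A \<le> ennreal K}" by simp
  then show "{A \<in> sets lebesgue. A \<subseteq> \<Omega> \<and> emeasure lebesgue A \<le> ennreal K} \<noteq> {}" by blast
qed (use assms in auto)

lemma penalty_nonneg:
  assumes "open \<Omega>" "v \<in> H1 \<Omega>"
  shows "0 \<le> penalty \<Omega> K v"
proof -
  have "largest_K_norm \<Omega> K (grad_sq \<Omega> v) \<le> L1_norm \<Omega> (grad_sq \<Omega> v)"
    using assms by (intro largest_K_norm_leI L1_norm_mono integrable_grad_sq) auto
  then show ?thesis by (simp add: penalty_def)
qed

text \<open>The L1 norm and the largest-K-norm are both 1-Lipschitz for the L1 distance, whence the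
  factor 2.\<close>

lemma penalty_le_add:
  assumes \<Omega>: "open \<Omega>" and v: "v \<in> H1 \<Omega>" and w: "w \<in> H1 \<Omega>"
  shows "penalty \<Omega> K w \<le> penalty \<Omega> K v + 2 * L1_norm \<Omega> (\<lambda>x. grad_sq \<Omega> v x - grad_sq \<Omega> w x)"
proof -
  let ?v = "grad_sq \<Omega> v" and ?w = "grad_sq \<Omega> w" and ?d = "L1_norm \<Omega> (\<lambda>x. grad_sq \<Omega> v x - grad_sq \<Omega> w x)"
  have \<Omega>': "\<Omega> \<in> sets lebesgue" using \<Omega> by auto
  note int = integrable_grad_sq[OF \<Omega> v] integrable_grad_sq[OF \<Omega> w]
  have sym: "L1_norm \<Omega> (\<lambda>x. ?w x - ?v x) = ?d"
    by (simp add: L1_norm_def abs_minus_commute)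
  have "L1_norm \<Omega> ?w \<le> L1_norm \<Omega> ?v + ?d"
    using L1_norm_triangle[OF int(2) int(1)] by (simp add: sym)
  moreover have "largest_K_norm \<Omega> K ?v \<le> largest_K_norm \<Omega> K ?w + ?d"
  proof (rule largest_K_norm_leI)
    fix A assume A: "A \<in> sets lebesgue" "A \<subseteq> \<Omega>" "emeasure lebesgue A \<le> ennreal K"
    have "L1_norm A ?v \<le> L1_norm A ?w + L1_norm A (\<lambda>x. ?v x - ?w x)"
      by (intro L1_norm_triangle integrable_lebesgue_on_subset[OF _ A(1,2) \<Omega>'] int)
    also have "L1_norm A (\<lambda>x. ?v x - ?w x) \<le> ?d"
      using int by (intro L1_norm_mono A \<Omega>') auto
    also have "L1_norm A ?w \<le> largest_K_norm \<Omega> K ?w"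
      by (rule L1_norm_le_largest_K_norm[OF \<Omega>' int(2) A])
    finally show "L1_norm A ?v \<le> largest_K_norm \<Omega> K ?w + ?d" by simp
  qed
  ultimately show ?thesis by (simp add: penalty_def)
qed

lemma grad_sq_superlevel_lmeasurable:
  assumes "open \<Omega>" "bounded \<Omega>" "v \<in> H1 \<Omega>"
  shows "{x \<in> \<Omega>. t < grad_sq \<Omega> v x} \<in> lmeasurable"
proof (rule fmeasurableI2)
  show "\<Omega> \<in> lmeasurable" using assms by (simp add: lmeasurable_open)
  have "{x \<in> space (lebesgue_on \<Omega>). t < grad_sq \<Omega> v x} \<in> sets (lebesgue_on \<Omega>)"
    using integrable_grad_sq[OF assms(1,3)] by measurable
  then show "{x \<in> \<Omega>. t < grad_sq \<Omega> v x} \<in> sets lebesgue"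
    using assms by (simp add: sets_restrict_space_iff)
qed auto

lemma grad_support_eq: "{x \<in> \<Omega>. weak_gradient \<Omega> v x \<noteq> 0} = {x \<in> \<Omega>. 0 < grad_sq \<Omega> v x}"
  using grad_sq_eq_0_iff[of \<Omega> v] grad_sq_nonneg[of \<Omega> v] by (force simp: less_le)

text \<open>The gradient support is itself admissible in the supremum and carries the whole mass of
  the squared gradient.\<close>

lemma penalty_eq_0_if_grad_L0_le:
  assumes \<Omega>: "open \<Omega>" "bounded \<Omega>" and v: "v \<in> H1 \<Omega>" and le: "grad_L0 \<Omega> v \<le> K"
  shows "penalty \<Omega> K v = 0"
proof -
  let ?A = "{x \<in> \<Omega>. 0 < grad_sq \<Omega> v x}"
  have \<Omega>': "\<Omega> \<in> sets lebesgue" using \<Omega> by auto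
  have A: "?A \<in> lmeasurable" by (rule grad_sq_superlevel_lmeasurable[OF \<Omega> v])
  have AL: "?A \<in> sets lebesgue" using A by auto
  have "emeasure lebesgue ?A \<le> ennreal K"
    using le A by (simp add: grad_L0_def grad_support_eq emeasure_eq_measure2 ennreal_leI)
  then have "L1_norm ?A (grad_sq \<Omega> v) \<le> largest_K_norm \<Omega> K (grad_sq \<Omega> v)"
    by (intro L1_norm_le_largest_K_norm integrable_grad_sq \<Omega> \<Omega>' v AL) auto
  moreover have "L1_norm (\<Omega> - ?A) (grad_sq \<Omega> v) = 0"
  proof -
    have "grad_sq \<Omega> v x = 0" if "x \<in> \<Omega> - ?A" for x
      using that grad_sq_nonneg[of \<Omega> v x] by auto
    then have "L1_norm (\<Omega> - ?A) (grad_sq \<Omega> v) = (\<integral>x. 0 \<partial>lebesgue_on (\<Omega> - ?A))"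
      unfolding L1_norm_def by (intro Bochner_Integration.integral_cong) auto
    then show ?thesis by simp
  qed
  ultimately have "penalty \<Omega> K v \<le> 0"
    using L1_norm_split[OF integrable_grad_sq[OF \<Omega>(1) v] AL _ \<Omega>'] by (simp add: penalty_def)
  then show ?thesis
    using penalty_nonneg[OF \<Omega>(1) v, of K] by simp
qed

text \<open>
  If the support is larger than \<open>K\<close>, so is a superlevel set \<open>{W > \<delta>}\<close>, and every set of measure
  at most \<open>K\<close> misses a part of it on which \<open>W\<close> has mass at least \<open>\<delta> (\<mu>{W > \<delta>} - K)\<close>.
\<close>

lemma grad_L0_le_if_penalty_le_0:
  assumes \<Omega>: "open \<Omega>" "bounded \<Omega>" and v: "v \<in> H1 \<Omega>" and K: "0 \<le> K" and pen: "penalty \<Omega> K v \<le> 0"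
  shows "grad_L0 \<Omega> v \<le> K"
proof (rule ccontr)
  assume neg: "\<not> grad_L0 \<Omega> v \<le> K"
  let ?W = "grad_sq \<Omega> v"
  \<comment> \<open>The levels 1/(n + 1) decrease to 0, so these sets exhaust the support;
    continuity of the measure from below then makes one of them larger than
    \<open>K\<close>.\<close>
  define S where "S n = {x \<in> \<Omega>. 1 / real (Suc n) < ?W x}" for n
  have \<Omega>': "\<Omega> \<in> sets lebesgue" using \<Omega> by auto
  note int = integrable_grad_sq[OF \<Omega>(1) v]
  have S: "S n \<in> lmeasurable" for n
    unfolding S_def by (rule grad_sq_superlevel_lmeasurable[OF \<Omega> v])
  have U: "(\<Union>n. S n) = {x \<in> \<Omega>. 0 < ?W x}"
  proof (intro equalityI subsetI)
    fix x assume x: "x \<in> {x \<in> \<Omega>. 0 < ?W x}"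
    then obtain n where "inverse (real (Suc n)) < ?W x"
      using reals_Archimedean by auto
    then show "x \<in> (\<Union>n. S n)" using x by (auto simp: S_def inverse_eq_divide)
  next
    fix x assume "x \<in> (\<Union>n. S n)"
    then obtain n where "x \<in> \<Omega>" "1 / real (Suc n) < ?W x" by (auto simp: S_def)
    moreover have "0 < 1 / real (Suc n)" by simp
    ultimately show "x \<in> {x \<in> \<Omega>. 0 < ?W x}" by (intro CollectI conjI) (assumption, linarith)
  qed
  have "incseq S"
    by (intro incseq_SucI) (auto simp: S_def elim!: le_less_trans[rotated] intro!: divide_left_mono)
  moreover have "emeasure lebesgue (\<Union>n. S n) \<noteq> \<infinity>"
    unfolding U infinity_ennreal_def by (rule fmeasurableD2[OF grad_sq_superlevel_lmeasurable[OF \<Omega> v]])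
  ultimately have "(\<lambda>n. measure lebesgue (S n)) \<longlonglongrightarrow> measure lebesgue (\<Union>n. S n)"
    using S by (intro Lim_measure_incseq) auto
  moreover have "K < measure lebesgue (\<Union>n. S n)"
    using neg by (simp add: U grad_L0_def grad_support_eq)
  ultimately have "\<forall>\<^sub>F n in sequentially. K < measure lebesgue (S n)"
    by (simp add: order_tendstoD)
  then obtain n where n: "K < measure lebesgue (S n)"
    by (auto simp: eventually_sequentially)
  define \<delta> where "\<delta> = 1 / real (Suc n)"
  have \<delta>: "0 < \<delta>" by (simp add: \<delta>_def)
  let ?m = "\<delta> * (measure lebesgue (S n) - K)"
  have "largest_K_norm \<Omega> K ?W \<le> L1_norm \<Omega> ?W - ?m"
  proof (rule largest_K_norm_leI)
    fix A assume A: "A \<in> sets lebesgue" "A \<subseteq> \<Omega>" "emeasure lebesgue A \<le> ennreal K"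
    have Af: "A \<in> lmeasurable"
      using A by (intro fmeasurableI) (auto intro: le_less_trans)
    \<comment> \<open>\<open>ennreal\<close> truncates negative numbers to 0, so passing to real
      measures relies on \<open>0 \<le> K\<close>.\<close>
    have "measure lebesgue A \<le> K"
      using A(3) K Af by (simp add: emeasure_eq_measure2)
    moreover have "measure lebesgue (S n) \<le> measure lebesgue (S n - A) + measure lebesgue A"
    proof -
      have "measure lebesgue (S n) \<le> measure lebesgue ((S n - A) \<union> A)"
        using S Af by (intro measure_mono_fmeasurable) auto
      also have "\<dots> \<le> measure lebesgue (S n - A) + measure lebesgue A"
        using S Af by (intro measure_Un_le) auto
      finally show ?thesis .
    qed
    ultimately have "?m \<le> \<delta> * measure lebesgue (S n - A)"
      using \<delta> by (intro mult_left_mono) auto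
    also have "\<dots> = (\<integral>x. \<delta> \<partial>lebesgue_on (S n - A))"
      using S Af by (simp add: measure_restrict_space)
    also have "\<dots> \<le> L1_norm (S n - A) ?W"
      unfolding L1_norm_def
    proof (rule integral_mono)
      have SA: "S n - A \<in> lmeasurable" using S Af by blast
      then show "integrable (lebesgue_on (S n - A)) (\<lambda>x. \<delta>)"
        by (intro finite_measure.integrable_const finite_measure_lebesgue_on)
      show "integrable (lebesgue_on (S n - A)) (\<lambda>x. \<bar>?W x\<bar>)"
        using SA by (intro integrable_abs integrable_lebesgue_on_subset[OF int _ _ \<Omega>']) (auto simp: S_def)
    qed (auto simp: S_def \<delta>_def)
    also have "\<dots> \<le> L1_norm (\<Omega> - A) ?W"
    proof (rule L1_norm_mono)
      show "integrable (lebesgue_on (\<Omega> - A)) ?W"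
        using A \<Omega>' by (intro integrable_lebesgue_on_subset[OF int _ _ \<Omega>']) auto
    qed (use S[of n] A \<Omega>' in \<open>auto simp: S_def\<close>)
    finally show "L1_norm A ?W \<le> L1_norm \<Omega> ?W - ?m"
      using L1_norm_split[OF int A(1,2) \<Omega>'] by simp
  qed
  moreover have "0 < ?m" using \<delta> n by simp
  ultimately show False using pen by (simp add: penalty_def)
qed

section \<open>Accumulation points under a compact embedding\<close>

locale compact_H1_embedding =
  fixes \<Omega> :: "(real^'n) set" and j :: "'u::real_normed_vector \<Rightarrow> real^'n \<Rightarrow> real"
  assumes open_domain: "open \<Omega>" and embedded: "compactly_embedded_H1 \<Omega> j"
begin

text \<open>The H1 norm pulled back to U, squared so that the quadratic estimates apply
  directly.\<close>

definition sqnorm :: "'u \<Rightarrow> real" where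
  "sqnorm u = (H1_norm \<Omega> (j u))\<^sup>2"

lemma j_H1: "j u \<in> H1 \<Omega>"
  using embedded by (simp add: compactly_embedded_H1_def)

lemma j_lincomb_AE: "AE x in lebesgue_on \<Omega>. j (a *\<^sub>R u + b *\<^sub>R v) x = a * j u x + b * j v x"
proof -
  have "AE x in lebesgue_on \<Omega>. j (a *\<^sub>R u + b *\<^sub>R v) x = j (a *\<^sub>R u) x + j (b *\<^sub>R v) x"
    "AE x in lebesgue_on \<Omega>. j (a *\<^sub>R u) x = a * j u x"
    "AE x in lebesgue_on \<Omega>. j (b *\<^sub>R v) x = b * j v x"
    using embedded by (auto simp: compactly_embedded_H1_def)
  then show ?thesis by eventually_elim simp
qed

lemma j_diff_AE: "AE x in lebesgue_on \<Omega>. j (u - v) x = j u x - j v x"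
  using j_lincomb_AE[of 1 u "-1" v] by simp

lemma sqnorm_lincomb_le:
  assumes "\<And>s t :: real. (a * s + b * t)\<^sup>2 \<le> \<alpha> * s\<^sup>2 + \<beta> * t\<^sup>2"
  shows "sqnorm (a *\<^sub>R u + b *\<^sub>R v) \<le> \<alpha> * sqnorm u + \<beta> * sqnorm v"
  unfolding sqnorm_def by (rule H1_norm_lincomb_bound[OF open_domain j_H1 j_H1 j_lincomb_AE assms])

lemma sqnorm_add_le: "sqnorm (u + v) \<le> 2 * sqnorm u + 2 * sqnorm v"
  using sqnorm_lincomb_le[OF sum_square_le] by simp

lemma convex_sqnorm_sublevel: "convex {b. sqnorm (b - z) \<le> e}"
  unfolding convex_alt
proof (intro ballI allI impI)
  fix a b and t :: real
  assume a: "a \<in> {b. sqnorm (b - z) \<le> e}" and b: "b \<in> {b. sqnorm (b - z) \<le> e}" and t: "0 \<le> t \<and> t \<le> 1"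
  have "((1 - t) * r + t * s)\<^sup>2 \<le> (1 - t) * r\<^sup>2 + t * s\<^sup>2" for r s :: real
  proof -
    have "(1 - t) * r\<^sup>2 + t * s\<^sup>2 - ((1 - t) * r + t * s)\<^sup>2 = t * (1 - t) * (r - s)\<^sup>2"
      by (simp add: power2_eq_square algebra_simps)
    moreover have "0 \<le> t * (1 - t) * (r - s)\<^sup>2" using t by simp
    ultimately show ?thesis by linarith
  qed
  then have "sqnorm ((1 - t) *\<^sub>R (a - z) + t *\<^sub>R (b - z)) \<le> (1 - t) * sqnorm (a - z) + t * sqnorm (b - z)"
    by (rule sqnorm_lincomb_le)
  also have "\<dots> \<le> (1 - t) * e + t * e"
    using a b t by (intro add_mono mult_left_mono) auto
  also have "\<dots> = e" by (simp add: algebra_simps)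
  also have "(1 - t) *\<^sub>R (a - z) + t *\<^sub>R (b - z) = (1 - t) *\<^sub>R a + t *\<^sub>R b - z"
    by (simp add: algebra_simps)
  finally show "(1 - t) *\<^sub>R a + t *\<^sub>R b \<in> {b. sqnorm (b - z) \<le> e}" by simp
qed

lemma sqnorm_le_norm_sq: "\<exists>C>0. \<forall>u. sqnorm u \<le> C * (norm u)\<^sup>2"
proof -
  obtain C where C: "\<And>u. H1_norm \<Omega> (j u) \<le> C * norm u"
    using embedded by (auto simp: compactly_embedded_H1_def)
  have "0 \<le> H1_norm \<Omega> (j u)" for u
    unfolding H1_norm_def by (intro real_sqrt_ge_zero add_nonneg_nonneg sum_nonneg) auto
  then have "sqnorm u \<le> (C * norm u)\<^sup>2" for u
    unfolding sqnorm_def using C by (intro power_mono)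
  \<comment> \<open>The summand 1 makes the constant strictly positive, as it will be divided by
    when a radius is chosen.\<close>
  then have "sqnorm u \<le> (C\<^sup>2 + 1) * (norm u)\<^sup>2" for u
    by (rule order_trans) (simp add: power_mult_distrib mult_right_mono)
  moreover have "0 < C\<^sup>2 + 1" by (simp add: add_nonneg_pos)
  ultimately show ?thesis by blast
qed

text \<open>The form in which compactness is used. The limit \<open>w\<close> lies in
  \<open>H1 \<Omega>\<close> and need not come from U, so two terms of the sequence are compared
  with each other instead of with the limit.\<close>

lemma sqnorm_bounded_sequence_close_pair:
  assumes s: "bounded (range s)" and e: "0 < e"
  shows "\<exists>m n::nat. m < n \<and> sqnorm (s n - s m) \<le> e"
proof -
  obtain r :: "nat \<Rightarrow> nat" and w where r: "strict_mono r" and w: "w \<in> H1 \<Omega>"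
    and lim: "(\<lambda>n. H1_norm \<Omega> (\<lambda>x. j (s (r n)) x - w x)) \<longlonglongrightarrow> 0"
  proof -
    have "\<exists>r w. strict_mono r \<and> w \<in> H1 \<Omega> \<and> (\<lambda>n. H1_norm \<Omega> (\<lambda>x. j (s (r n)) x - w x)) \<longlonglongrightarrow> 0"
      using embedded s unfolding compactly_embedded_H1_def by simp
    then show ?thesis using that by blast
  qed
  let ?N = "\<lambda>n. (H1_norm \<Omega> (\<lambda>x. j (s (r n)) x - w x))\<^sup>2"
  have N: "?N \<longlonglongrightarrow> 0"
    using tendsto_power[OF lim, of 2] by simp
  then have "\<forall>\<^sub>F n in sequentially. ?N n < e / 4"
    using e by (intro order_tendstoD(2)[OF N]) simp
  then obtain n where n: "\<And>m. n \<le> m \<Longrightarrow> ?N m < e / 4"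
    by (auto simp: eventually_sequentially)
  have "sqnorm (s (r (Suc n)) - s (r n)) \<le> 2 * ?N (Suc n) + 2 * ?N n"
    unfolding sqnorm_def
  proof (rule H1_norm_lincomb_bound[OF open_domain _ _ _ diff_square_le])
    show "AE x in lebesgue_on \<Omega>. j (s (r (Suc n)) - s (r n)) x
        = 1 * (j (s (r (Suc n))) x - w x) + (- 1) * (j (s (r n)) x - w x)"
      using j_diff_AE by eventually_elim simp
  qed (intro H1_diff open_domain j_H1 w)+
  also have "\<dots> \<le> e"
    using n[of n] n[of "Suc n"] by simp
  finally show ?thesis
    using r by (meson lessI strict_monoD)
qed

text \<open>
  If the iterates stayed away from \<open>z\<close>, then \<open>z\<close> would be weakly separated from the convex balls
  around any finitely many of them, so a further iterate avoids all these balls. The resulting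
  subsequence with pairwise distances bounded below contradicts compactness.
\<close>

lemma weak_accumulation_point_imp_H1_close:
  assumes bdd: "bounded (range u)" and acc: "weak_accumulation_point z u" and e: "0 < e"
  shows "\<exists>\<^sub>F k in sequentially. sqnorm (u k - z) \<le> e"
proof (rule ccontr)
  assume "\<not> (\<exists>\<^sub>F k in sequentially. sqnorm (u k - z) \<le> e)"
  then obtain N where N: "\<And>k. N \<le> k \<Longrightarrow> e < sqnorm (u k - z)"
    by (auto simp: not_frequently eventually_sequentially not_le)
  obtain C where C: "0 < C" "\<And>v. sqnorm v \<le> C * (norm v)\<^sup>2"
    using sqnorm_le_norm_sq by blast
  \<comment> \<open>Chosen so that C d^2 = e/4: an H1 distance with square above e/4 then forces
    norm distance at least d.\<close>
  define d where "d = sqrt (e / (4 * C))"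
  have d: "0 < d" "C * d\<^sup>2 = e / 4"
    using e C by (auto simp: d_def)
  have sqnorm_minus: "sqnorm (v - w) \<le> sqnorm (w - v)" for v w
    using sqnorm_lincomb_le[of "-1" 0 1 0 "w - v" 0] by simp
  have sep: "\<exists>V. openin weak_topology V \<and> z \<in> V \<and> V \<inter> {b. sqnorm (b - u l) \<le> e / 4} = {}" if l: "N \<le> l" for l
  proof (rule convex_separation_weak_neighbourhood[OF convex_sqnorm_sublevel d(1)])
    fix b assume "b \<in> {b. sqnorm (b - u l) \<le> e / 4}"
    then have "sqnorm (u l - b) \<le> e / 4"
      using sqnorm_minus[of "u l" b] by simp
    moreover have "sqnorm (u l - z) \<le> 2 * sqnorm (u l - b) + 2 * sqnorm (b - z)"
      using sqnorm_add_le[of "u l - b" "b - z"] by simp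
    \<comment> \<open>From e < 2 (e/4) + 2 \<open>sqnorm (b - z)\<close>: radius e/4 around
      \<open>u l\<close> leaves the same margin e/4 around \<open>z\<close>.\<close>
    ultimately have "e / 4 < sqnorm (b - z)"
      using N[OF l] by linarith
    then have "C * d\<^sup>2 < C * (norm (b - z))\<^sup>2"
      using C(2)[of "b - z"] d(2) by linarith
    then have "d\<^sup>2 < (norm (b - z))\<^sup>2"
      using C(1) by simp
    then show "d \<le> norm (b - z)"
      by (meson less_imp_le norm_ge_zero power2_less_imp_less)
  qed
  have extend: "\<exists>k\<ge>N. \<forall>l\<in>L. e / 4 < sqnorm (u k - u l)" if L: "finite L" "L \<subseteq> {N..}" for L
  proof (cases "L = {}")
    case False
    have "\<forall>l\<in>L. \<exists>V. openin weak_topology V \<and> z \<in> V \<and> V \<inter> {b. sqnorm (b - u l) \<le> e / 4} = {}"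
      using sep L by auto
    then obtain V where V: "\<And>l. l \<in> L \<Longrightarrow> openin weak_topology (V l) \<and> z \<in> V l \<and>
        V l \<inter> {b. sqnorm (b - u l) \<le> e / 4} = {}"
      by metis
    have "openin weak_topology (\<Inter>l\<in>L. V l)"
      using V L False by (intro openin_INT2) auto
    then have "\<exists>\<^sub>F k in sequentially. u k \<in> (\<Inter>l\<in>L. V l)"
      using acc V by (auto simp: weak_accumulation_point_def)
    then obtain k where "N \<le> k" "u k \<in> (\<Inter>l\<in>L. V l)"
      by (auto simp: frequently_sequentially)
    then show ?thesis
      using V by (intro exI[of _ k]) (auto simp: disjoint_iff not_le)
  qed auto
  \<comment> \<open>Each choice must avoid the balls around all earlier ones, hence recursion over
    the full history. The indices \<open>n i\<close> need not increase, since compactness is applied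
    to the selected sequence itself.\<close>
  have "\<exists>n. \<forall>i::nat. N \<le> n i \<and> (\<forall>l<i. e / 4 < sqnorm (u (n i) - u (n l)))"
  proof (rule dependent_wf_choice[where P = "\<lambda>f (i::nat) r. N \<le> r \<and> (\<forall>l<i. e / 4 < sqnorm (u r - u (f l)))",
        OF wf_less])
    fix i and f :: "nat \<Rightarrow> nat"
    assume IH: "\<And>l. (l, i) \<in> {(l, i). l < i} \<Longrightarrow> N \<le> f l \<and> (\<forall>k<l. e / 4 < sqnorm (u (f l) - u (f k)))"
    show "\<exists>r. N \<le> r \<and> (\<forall>l<i. e / 4 < sqnorm (u r - u (f l)))"
    proof -
      have "f ` {..<i} \<subseteq> {N..}" using IH by auto
      then obtain r where "N \<le> r" "\<forall>l\<in>f ` {..<i}. e / 4 < sqnorm (u r - u l)"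
        using extend[of "f ` {..<i}"] by auto
      then show ?thesis by auto
    qed
  qed simp
  then obtain n where "\<forall>i::nat. N \<le> n i \<and> (\<forall>l<i. e / 4 < sqnorm (u (n i) - u (n l)))" ..
  then have n: "e / 4 < sqnorm (u (n i) - u (n l))" if "l < i" for i l
    using that by simp
  have "bounded (range (\<lambda>i. u (n i)))"
    using bdd by (rule bounded_subset) auto
  then obtain l i where "l < i" "sqnorm (u (n i) - u (n l)) \<le> e / 4"
    using sqnorm_bounded_sequence_close_pair[of "\<lambda>i. u (n i)" "e / 4"] e by auto
  then show False using n[of l i] by simp
qed

lemma penalty_le_sqnorm:
  assumes "0 < \<delta>"
  shows "penalty \<Omega> K (j z) \<le> penalty \<Omega> K (j u)
    + 2 * ((1 + 1 / \<delta>) * sqnorm (u - z) + \<delta> * L1_norm \<Omega> (grad_sq \<Omega> (j z)))"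
  using penalty_le_add[OF open_domain j_H1 j_H1, of K z u]
    mult_left_mono[OF L1_norm_grad_sq_diff[OF open_domain j_H1 j_H1 j_H1 j_diff_AE assms, of u z],
      of 2]
  by (simp add: sqnorm_def)

lemma penalty_weak_accumulation_point_le_0:
  assumes bdd: "bounded (range u)" and acc: "weak_accumulation_point z u"
    and lim: "(\<lambda>k. penalty \<Omega> K (j (u k))) \<longlonglongrightarrow> 0"
  shows "penalty \<Omega> K (j z) \<le> 0"
proof (rule field_le_epsilon)
  fix \<epsilon> :: real assume \<epsilon>: "0 < \<epsilon>"
  define L where "L = L1_norm \<Omega> (grad_sq \<Omega> (j z))"
  have L: "0 \<le> L" by (simp add: L_def L1_norm_nonneg)
  \<comment> \<open>Error budget: \<epsilon>/2 for the penalty of the iterate and 2 (\<epsilon>/8 +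
    \<epsilon>/8) for the difference. \<delta> is fixed before e, which depends on it through c = 1
    + 1/\<delta>; L + 1 avoids division by zero.\<close>
  define \<delta> where "\<delta> = \<epsilon> / (8 * (L + 1))"
  have \<delta>: "0 < \<delta>" using \<epsilon> L by (simp add: \<delta>_def)
  have "\<delta> * L \<le> \<delta> * (L + 1)" using \<delta> by simp
  also have "\<dots> = \<epsilon> / 8" using L by (simp add: \<delta>_def field_simps)
  finally have \<delta>L: "\<delta> * L \<le> \<epsilon> / 8" .
  define c where "c = 1 + 1 / \<delta>"
  have pos: "0 < c" using \<delta> by (simp add: c_def add_pos_pos)
  define e where "e = \<epsilon> / (8 * c)"
  have e: "0 < e" "c * e = \<epsilon> / 8"
    using \<epsilon> pos by (auto simp: e_def)
  have "\<forall>\<^sub>F k in sequentially. penalty \<Omega> K (j (u k)) < \<epsilon> / 2"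
    using \<epsilon> by (intro order_tendstoD(2)[OF lim]) simp
  \<comment> \<open>Closeness holds frequently and smallness of the penalty eventually, so some
    index has both.\<close>
  then have "\<exists>\<^sub>F k in sequentially. sqnorm (u k - z) \<le> e \<and> penalty \<Omega> K (j (u k)) < \<epsilon> / 2"
    using weak_accumulation_point_imp_H1_close[OF bdd acc e(1)] by (rule frequently_eventually_frequently[rotated])
  then obtain k where k: "sqnorm (u k - z) \<le> e" "penalty \<Omega> K (j (u k)) < \<epsilon> / 2"
    using frequently_ex by blast
  have "c * sqnorm (u k - z) \<le> c * e"
    using k(1) pos by (intro mult_left_mono) auto
  then show "penalty \<Omega> K (j z) \<le> 0 + \<epsilon>"
    using penalty_le_sqnorm[OF \<delta>, of K z "u k"] k(2) \<delta>L e(2) unfolding L_def[symmetric] c_def[symmetric] by simp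
qed

end

section \<open>Sublevel sets of the objective and the convergence theorem\<close>

lemma convex_ereal_sublevel:
  assumes "ereal_convex f"
  shows "convex {x. f x \<le> ereal r}"
  unfolding convex_alt
proof (intro ballI allI impI)
  fix x y and t :: real
  assume x: "x \<in> {x. f x \<le> ereal r}" and y: "y \<in> {x. f x \<le> ereal r}" and t: "0 \<le> t \<and> t \<le> 1"
  have "f ((1 - t) *\<^sub>R x + t *\<^sub>R y) \<le> ereal (1 - t) * f x + ereal t * f y"
    using assms t by (auto simp: ereal_convex_def)
  also have "\<dots> \<le> ereal (1 - t) * ereal r + ereal t * ereal r"
    using x y t by (intro add_mono ereal_mult_left_mono) auto
  also have "\<dots> = ereal r" by (simp add: algebra_simps)
  finally show "(1 - t) *\<^sub>R x + t *\<^sub>R y \<in> {x. f x \<le> ereal r}" by simp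
qed

text \<open>\<open>Liminf\<close> along \<open>at x\<close> ignores the point itself, which fits the
  description of closed sets by limit points.\<close>

lemma closed_lower_semicontinuous_sublevel:
  assumes "lower_semicontinuous f"
  shows "closed {x. f x \<le> a}"
  unfolding closed_limpt
proof (intro allI impI)
  fix x assume lim: "x islimpt {x. f x \<le> a}"
  show "x \<in> {x. f x \<le> a}"
  proof (rule ccontr)
    assume "x \<notin> {x. f x \<le> a}"
    moreover have "f x \<le> Liminf (at x) f"
      using assms by (simp add: lower_semicontinuous_def)
    ultimately have "a < Liminf (at x) f" by simp
    then have "\<forall>\<^sub>F y in at x. a < f y" by (rule less_LiminfD)
    then show False
      using lim by (simp add: islimpt_iff_eventually not_le)
  qed
qed

theorem theorem3p5:
  fixes \<Omega> :: "(real^'n) set"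
    and j :: "'u::banach \<Rightarrow> real^'n \<Rightarrow> real"
    and f :: "'u \<Rightarrow> ereal"
    and K :: real
    and \<rho> :: "nat \<Rightarrow> real"
    and u :: "nat \<Rightarrow> 'u"
  assumes "open \<Omega>" and "bounded \<Omega>"
    and "reflexive_space TYPE('u)"
    and "compactly_embedded_H1 \<Omega> j"
    and "dense_in_L1 \<Omega> j"
    and f_proper: "\<forall>v. f v \<noteq> -\<infinity>" "\<exists>v. f v \<noteq> \<infinity>"
    and "ereal_convex f"
    and "lower_semicontinuous f"
    and f_bounded_below: "\<exists>c::real. \<forall>v. ereal c \<le> f v"
    and f_radially_unbounded: "(f \<longlongrightarrow> \<infinity>) at_infinity"
    and "0 \<le> K" and "K \<le> measure lebesgue \<Omega>"
    and feasible: "\<exists>v. f v < \<infinity> \<and> grad_L0 \<Omega> (j v) \<le> K"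
    and \<rho>_pos: "\<forall>k. \<rho> k > 0"
    and \<rho>_lim: "filterlim \<rho> at_top sequentially"
    and u_sol: "\<forall>k. is_arg_min (\<lambda>v. f v + ereal (\<rho> k * penalty \<Omega> K (j v))) (\<lambda>_. True) (u k)"
  shows "bounded (range u) \<and>
    (\<lambda>k. penalty \<Omega> K (j (u k))) \<longlonglongrightarrow> 0 \<and>
    (\<forall>ubar. weak_accumulation_point ubar u \<longrightarrow>
       is_arg_min f (\<lambda>v. grad_L0 \<Omega> (j v) \<le> K) ubar)"
proof -
  interpret compact_H1_embedding \<Omega> j
    using assms by unfold_locales
  let ?\<phi> = "\<lambda>v. penalty \<Omega> K (j v)"
  have \<phi>_nonneg: "0 \<le> ?\<phi> v" for v
    by (rule penalty_nonneg[OF \<open>open \<Omega>\<close> j_H1])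
  have le_feasible: "f (u k) + ereal (\<rho> k * ?\<phi> (u k)) \<le> f v" if "grad_L0 \<Omega> (j v) \<le> K" for k v
    using u_sol penalty_eq_0_if_grad_L0_le[OF \<open>open \<Omega>\<close> \<open>bounded \<Omega>\<close> j_H1 that]
    by (simp add: is_arg_min_def not_less) (metis add.right_neutral mult_zero_right zero_ereal_def)
  have f_le_feasible: "f (u k) \<le> f v" if "grad_L0 \<Omega> (j v) \<le> K" for k v
  proof -
    have "f (u k) + 0 \<le> f (u k) + ereal (\<rho> k * ?\<phi> (u k))"
      using \<phi>_nonneg[of "u k"] \<rho>_pos by (intro add_left_mono) (simp add: less_imp_le)
    also have "\<dots> \<le> f v" by (rule le_feasible[OF that])
    finally show ?thesis by simp
  qed
  obtain v r where v: "grad_L0 \<Omega> (j v) \<le> K" "f v = ereal r"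
  proof -
    obtain v where "f v < \<infinity>" "grad_L0 \<Omega> (j v) \<le> K" using feasible by blast
    then show ?thesis using that[of v] f_proper(1) by (cases "f v") auto
  qed
  have bdd: "bounded (range u)"
  proof -
    have "\<forall>\<^sub>F x in at_infinity. ereal r < f x"
      using f_radially_unbounded by (simp add: tendsto_PInfty)
    then obtain b where b: "\<And>x. b \<le> norm x \<Longrightarrow> ereal r < f x"
      by (auto simp: eventually_at_infinity)
    have "norm (u k) \<le> b" for k
    proof (rule ccontr)
      assume "\<not> norm (u k) \<le> b"
      then have "f v < f (u k)" using b[of "u k"] v(2) by simp
      then show False using f_le_feasible[OF v(1), of k] by simp
    qed
    then show ?thesis
      by (auto simp: bounded_iff)
  qed
  have lim: "(\<lambda>k. ?\<phi> (u k)) \<longlonglongrightarrow> 0"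
  proof -
    obtain c :: real where c: "\<And>v. ereal c \<le> f v" using f_bounded_below by blast
    have upper: "?\<phi> (u k) \<le> (r - c) / \<rho> k" for k
    proof -
      have "ereal c + ereal (\<rho> k * ?\<phi> (u k)) \<le> f (u k) + ereal (\<rho> k * ?\<phi> (u k))"
        by (intro add_right_mono c)
      also have "\<dots> \<le> ereal r" using le_feasible[OF v(1), of k] v(2) by simp
      finally have "c + \<rho> k * ?\<phi> (u k) \<le> r" by simp
      then show ?thesis using \<rho>_pos by (simp add: field_simps)
    qed
    have "(\<lambda>k. (r - c) / \<rho> k) \<longlonglongrightarrow> 0"
      by (rule real_tendsto_divide_at_top[OF tendsto_const \<rho>_lim])
    then show ?thesis
      by (rule tendsto_sandwich[OF _ _ tendsto_const, rotated 2])
        (intro always_eventually allI \<phi>_nonneg upper)+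
  qed
  have "is_arg_min f (\<lambda>v. grad_L0 \<Omega> (j v) \<le> K) z" if z: "weak_accumulation_point z u" for z
  proof -
    have "grad_L0 \<Omega> (j z) \<le> K"
      using penalty_weak_accumulation_point_le_0[OF bdd z lim]
      by (rule grad_L0_le_if_penalty_le_0[OF \<open>open \<Omega>\<close> \<open>bounded \<Omega>\<close> j_H1 \<open>0 \<le> K\<close>])
    moreover have "f z \<le> f y" if y: "grad_L0 \<Omega> (j y) \<le> K" for y
    proof (cases "f y")
      \<comment> \<open>Every iterate lies in the closed convex set {f \<le> a}, and so does
        \<open>z\<close>. The value \<infinity> needs no argument, and properness excludes
        -\<infinity>.\<close>
      case (real a)
      have "z \<in> {x. f x \<le> ereal a}"
        using z f_le_feasible[OF y] real \<open>ereal_convex f\<close> \<open>lower_semicontinuous f\<close>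
        by (intro weak_accumulation_point_in_closed_convex[OF z] convex_ereal_sublevel
            closed_lower_semicontinuous_sublevel) auto
      then show ?thesis using real by simp
    qed (use f_proper(1) in auto)
    ultimately show ?thesis
      by (auto simp: is_arg_min_def not_less)
  qed
  then show ?thesis using bdd lim by blast
qed

end
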